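(* Let $(X,r)$ be a square-free solution of finite order $|X|=n$ and cyclic degree $p=p(X,r)$, let $G=G(X,r)$ and let $(G,r_G)$ be the associated involutive braided group, with socle $\Gamma$. Let $\mathcal{G}=\mathcal{G}(X,r)$ be the permutation group of $(X,r)$. Fix an admissible enumeration $X=\{x_1<\cdots<x_n\}$ (as defined in the context), let $Y=\{x_1^{\alpha_1}\cdots x_n^{\alpha_n}\mid 0\le\alpha_i\le p-1,\ 1\le i\le n\}$, and let $\mathcal{F}_p$ be the subgroup of $G$ generated by $x_1^p,\dots,x_n^p$. Then: (1) $\mathcal{F}_p$ is an ideal of $(G,r_G)$, and there is a chain of ideals $\mathcal{F}_p\triangleleft\Gamma\triangleleft G$ in $G$. (2) The quotient group $\widetilde G=G/\mathcal{F}_p$ is an involutive braided group of finite order $p^n$. More precisely, the canonical projection $\pi:G\to\widetilde G=G/\mathcal{F}_p$, $g=yW\mapsto\tilde g=\tilde y$ ($y\in Y$, $W\in\mathcal{F}_p$), induces the structure of an involutive braided group on the finite set $\widetilde G=\tilde Y:=\{\tilde y\mid y\in Y\}$, such that the induced operation on $\tilde Y$ is well defined by $$\tilde y\cdot\tilde z:=\tilde t,\quad\text{where } yz=tW \text{ holds in } G,\ y,z,t\in Y,\ W\in\mathcal{F}_p.$$ The restriction $\pi_{|Y}:Y\to\tilde Y=\widetilde G$ is a bijective map of sets of order $p^n$. (3) The map $X\to\tilde X\subseteq\widetilde G$, $x\mapsto\tilde x=\pi(x)$, is an embedding of $X$ into the braided group $\widetilde G$; identifying $X$ with $\tilde X$,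 $X$ is a set of generators of the braided group $\widetilde G$ of order $p^n$. (4) There is a canonical epimorphism of braided groups $\widetilde G\twoheadrightarrow\mathcal{G}\simeq G/\Gamma$, so the order $|\mathcal{G}|$ divides $p^n$. Moreover, if $p$ is a prime number, then $\mathcal{G}$ is a $p$-group.
   Context: Quadratic sets and solutions. Let $X$ be a nonempty set and $r:X\times X\to X\times X$ a bijection, written $r(x,y)=({}^xy,x^y)$. Put $\mathcal{L}_x(y)={}^xy$ and $\mathcal{R}_y(x)=x^y$. The map $r$ is nondegenerate if all $\mathcal{L}_x,\mathcal{R}_x$ are bijections of $X$; involutive if $r^2=\mathrm{id}$; $(X,r)$ is square-free if $r(x,x)=(x,x)$ for all $x\in X$; $r$ is a set-theoretic solution of the Yang–Baxter equation if $r^{12}r^{23}r^{12}=r^{23}r^{12}r^{23}$ on $X\times X\times X$, where $r^{12}=r\times\mathrm{id}_X$, $r^{23}=\mathrm{id}_X\times r$. Here "a solution" means a pair $(X,r)$ with $r$ nondegenerate, involutive and satisfying the Yang–Baxter equation. Associated objects. Let $\Re$ be the set of relations $xy=zt$ for all $x,y,z,t\in X$ with $r(x,y)=(z,t)$ and $(x,y)\ne(z,t)$. $S=S(X,r)$ is the monoid, $G=G(X,r)$ the group, and $A=A(\mathbf{k},X,r)$ the unital associative algebra over a field $\mathbf{k}$, generated by $X$ with defining relations $\Re$. For finite $(X,r)$ the canonical maps $X\to S\to G$ are injective, and $A$ is the monoid algebra $\mathbf{k}S$. The assignment $x\mapsto\mathcal{L}_x$ extends to a group homomorphism $\mathcal{L}:G\to\mathrm{Sym}(X)$;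 its image is the permutation group $\mathcal{G}=\mathcal{G}(X,r)$. Cyclic degree. For a finite solution, $p=p(X,r)$ is the least common multiple of the orders of the permutations $\mathcal{L}_x$, $x\in X$. Braided groups. A braided group is a pair $(G,\sigma)$ with $G$ a group and $\sigma:G\times G\to G\times G$, $\sigma(a,u)=({}^au,a^u)$, a bijection such that for all $a,b,u,v\in G$: ${}^a1=1$, ${}^1u=u$, ${}^{ab}u={}^a({}^bu)$, ${}^a(uv)=({}^au)({}^{a^u}v)$; $1^u=1$, $a^1=a$, $a^{uv}=(a^u)^v$, $(ab)^u=(a^{{}^bu})(b^u)$; and $uv=({}^uv)(u^v)$. It is involutive if $\sigma^2=\mathrm{id}$. Homomorphisms of braided groups are group homomorphisms compatible with the braidings. For a solution $(X,r)$ there is a unique map $r_G$ on $G\times G$, $G=G(X,r)$, extending $r$ on $X\times X$ and making $(G,r_G)$ a braided group, and it is involutive; $(G,r_G)$ is the involutive braided group associated to $(X,r)$. Ideals, socle, quotients. An ideal of an involutive braided group $(G,\sigma)$ is a normal subgroup $H$ of $G$ with ${}^gh\in H$ for all $g\in G,h\in H$ (equivalently $h^g\in H$ for all $g\in G$, $h\in H$). The quotient $G/H$ by an ideal carries a canonical involutive braided group structure for which the projection is a homomorphism of braided groups. The socle is $\Gamma=\{a\in G\mid{}^au=u\ \forall u\in G\}=\{a\in G\mid u^a=u\ \forall u\in G\}$; it is an ideal and an abelian group. For a solution $(X,r)$ there is a group isomorphism $G/\Gamma\simeq\mathcal{G}(X,r)$ induced by $\mathcal{L}$, through which $\mathcal{G}$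 is given the structure of an involutive braided group. Admissible enumeration. An enumeration $X=\{x_1<\dots<x_n\}$ of a finite square-free solution is called admissible if $A$ is, with respect to it, a binomial skew polynomial ring, that is: $\Re$ consists of exactly $\binom n2$ relations $x_jx_i=x_{i'}x_{j'}$, one for each pair $1\le i<j\le n$, with $j>i'$ and $i'<j'$; every monomial $x_ix_j$ with $i<j$ occurs as the right-hand side of some relation; and the set of ordered monomials $\mathcal{N}=\{x_1^{\alpha_1}\cdots x_n^{\alpha_n}\mid\alpha_i\ge0\}$ is a $\mathbf{k}$-basis of $A$ (equivalently, each element of $S$ is represented by a unique word in $\mathcal{N}$). It is a known theorem that an admissible enumeration always exists for a finite square-free solution. Elements of $\mathcal{N}$, in particular of $Y$, are regarded as elements of $S\subseteq G$. It is also known that every $u\in G$ has a unique presentation $u=yW$ with $y\in Y$, $W\in\mathcal{F}_p$.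
   Formalization: In part (3), injectivity of X → G̃ is claimed only when p ≠ 1 or n = 1: for p = 1 and n ≥ 2 (e.g. the trivial solution r(x,y) = (y,x)) the group G̃ has order 1, so X cannot embed and the claim as stated is false. *)

theory Defs
  imports
    "HOL-Algebra.Bij"
    "HOL-Algebra.Generated_Groups"
    "HOL-Algebra.Multiplicative_Group"
    "HOL-Library.Poly_Mapping"
    "HOL-Computational_Algebra.Primes"
begin

section \<open>Set-theoretic solutions of the Yang--Baxter equation\<close>

definition lact :: "('a \<times> 'a \<Rightarrow> 'a \<times> 'a) \<Rightarrow> 'a \<Rightarrow> 'a \<Rightarrow> 'a" where
  "lact r x y = fst (r (x, y))"

text \<open>Argument order: \<open>ract r x y\<close> is $x^y$, so $\mathcal{R}_y$ is \<open>\<lambda>x. ract r x y\<close>.\<close>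

definition ract :: "('a \<times> 'a \<Rightarrow> 'a \<times> 'a) \<Rightarrow> 'a \<Rightarrow> 'a \<Rightarrow> 'a" where
  "ract r x y = snd (r (x, y))"

definition nondegenerate :: "'a set \<Rightarrow> ('a \<times> 'a \<Rightarrow> 'a \<times> 'a) \<Rightarrow> bool" where
  "nondegenerate X r \<longleftrightarrow>
     (\<forall>x\<in>X. bij_betw (\<lambda>y. lact r x y) X X \<and> bij_betw (\<lambda>y. ract r y x) X X)"

definition involutive_on :: "'a set \<Rightarrow> ('a \<times> 'a \<Rightarrow> 'a \<times> 'a) \<Rightarrow> bool" where
  "involutive_on X r \<longleftrightarrow> (\<forall>a\<in>X \<times> X. r (r a) = a)"

definition square_free :: "'a set \<Rightarrow> ('a \<times> 'a \<Rightarrow> 'a \<times> 'a) \<Rightarrow> bool" where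
  "square_free X r \<longleftrightarrow> (\<forall>x\<in>X. r (x, x) = (x, x))"

definition r12 :: "('a \<times> 'a \<Rightarrow> 'a \<times> 'a) \<Rightarrow> 'a \<times> 'a \<times> 'a \<Rightarrow> 'a \<times> 'a \<times> 'a" where
  "r12 r = (\<lambda>(x, y, z). (fst (r (x, y)), snd (r (x, y)), z))"

definition r23 :: "('a \<times> 'a \<Rightarrow> 'a \<times> 'a) \<Rightarrow> 'a \<times> 'a \<times> 'a \<Rightarrow> 'a \<times> 'a \<times> 'a" where
  "r23 r = (\<lambda>(x, y, z). (x, r (y, z)))"

definition yang_baxter :: "'a set \<Rightarrow> ('a \<times> 'a \<Rightarrow> 'a \<times> 'a) \<Rightarrow> bool" where
  "yang_baxter X r \<longleftrightarrow>
     (\<forall>t\<in>X \<times> X \<times> X. r12 r (r23 r (r12 r t)) = r23 r (r12 r (r23 r t)))"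

definition solution :: "'a set \<Rightarrow> ('a \<times> 'a \<Rightarrow> 'a \<times> 'a) \<Rightarrow> bool" where
  "solution X r \<longleftrightarrow>
     X \<noteq> {} \<and> bij_betw r (X \<times> X) (X \<times> X) \<and>
     nondegenerate X r \<and> involutive_on X r \<and> yang_baxter X r"

text \<open>The permutations $\mathcal{L}_x$, as elements of $\mathrm{Sym}(X)$.\<close>

definition Lperm :: "'a set \<Rightarrow> ('a \<times> 'a \<Rightarrow> 'a \<times> 'a) \<Rightarrow> 'a \<Rightarrow> ('a \<Rightarrow> 'a)" where
  "Lperm X r x = (\<lambda>y\<in>X. lact r x y)"

definition cyclic_degree :: "'a set \<Rightarrow> ('a \<times> 'a \<Rightarrow> 'a \<times> 'a) \<Rightarrow> nat" where
  "cyclic_degree X r = Lcm ((\<lambda>x. group.ord (BijGroup X) (Lperm X r x)) ` X)"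


section \<open>The associated group and algebra\<close>

text \<open>The defining relations; the pair \<open>(v, w)\<close> stands for the equation $v = w$.\<close>

definition relators :: "'a set \<Rightarrow> ('a \<times> 'a \<Rightarrow> 'a \<times> 'a) \<Rightarrow> ('a list \<times> 'a list) set" where
  "relators X r =
     {([x, y], [z, t]) | x y z t. x \<in> X \<and> y \<in> X \<and> r (x, y) = (z, t) \<and> (x, y) \<noteq> (z, t)}"

text \<open>Group words are lists of signed letters, where \<open>(x, True)\<close> stands for $x$ and
  \<open>(x, False)\<close> for $x^{-1}$; the group is the set of words modulo the congruence
  generated by free cancellation and the defining relations.\<close>

inductive gcong ::
  "'a set \<Rightarrow> ('a \<times> 'a \<Rightarrow> 'a \<times> 'a) \<Rightarrow> ('a \<times> bool) list \<Rightarrow> ('a \<times> bool) list \<Rightarrow> bool"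
  for X r where
  refl: "w \<in> lists (X \<times> UNIV) \<Longrightarrow> gcong X r w w"
| sym: "gcong X r v w \<Longrightarrow> gcong X r w v"
| trans: "gcong X r u v \<Longrightarrow> gcong X r v w \<Longrightarrow> gcong X r u w"
| cancel: "u \<in> lists (X \<times> UNIV) \<Longrightarrow> v \<in> lists (X \<times> UNIV) \<Longrightarrow> x \<in> X \<Longrightarrow>
    gcong X r (u @ [(x, b), (x, \<not> b)] @ v) (u @ v)"
| rel: "u \<in> lists (X \<times> UNIV) \<Longrightarrow> v \<in> lists (X \<times> UNIV) \<Longrightarrow> (a, c) \<in> relators X r \<Longrightarrow>
    gcong X r (u @ map (\<lambda>x. (x, True)) a @ v) (u @ map (\<lambda>x. (x, True)) c @ v)"

definition gclass ::
  "'a set \<Rightarrow> ('a \<times> 'a \<Rightarrow> 'a \<times> 'a) \<Rightarrow> ('a \<times> bool) list \<Rightarrow> ('a \<times> bool) list set" where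
  "gclass X r w = {w'. gcong X r w w'}"

definition structure_group ::
  "'a set \<Rightarrow> ('a \<times> 'a \<Rightarrow> 'a \<times> 'a) \<Rightarrow> ('a \<times> bool) list set monoid" where
  "structure_group X r =
     \<lparr>carrier = gclass X r ` lists (X \<times> UNIV),
      monoid.mult = (\<lambda>A B. {w. \<exists>u\<in>A. \<exists>v\<in>B. gcong X r (u @ v) w}),
      one = gclass X r []\<rparr>"

definition word_elt ::
  "'a set \<Rightarrow> ('a \<times> 'a \<Rightarrow> 'a \<times> 'a) \<Rightarrow> 'a list \<Rightarrow> ('a \<times> bool) list set" where
  "word_elt X r w = gclass X r (map (\<lambda>x. (x, True)) w)"

definition gen ::
  "'a set \<Rightarrow> ('a \<times> 'a \<Rightarrow> 'a \<times> 'a) \<Rightarrow> 'a \<Rightarrow> ('a \<times> bool) list set" where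
  "gen X r x = word_elt X r [x]"

text \<open>The homomorphism $\mathcal{L} : G(X,r) \to \mathrm{Sym}(X)$: the product of the
  permutations $\mathcal{L}_x^{\pm 1}$ along a word, which depends only on the class of the word.\<close>

definition perm_word ::
  "'a set \<Rightarrow> ('a \<times> 'a \<Rightarrow> 'a \<times> 'a) \<Rightarrow> ('a \<times> bool) list \<Rightarrow> ('a \<Rightarrow> 'a)" where
  "perm_word X r w =
     foldr (\<lambda>(x, b) g.
         (if b then Lperm X r x else inv\<^bsub>BijGroup X\<^esub> (Lperm X r x)) \<otimes>\<^bsub>BijGroup X\<^esub> g)
       w \<one>\<^bsub>BijGroup X\<^esub>"

definition perm_hom ::
  "'a set \<Rightarrow> ('a \<times> 'a \<Rightarrow> 'a \<times> 'a) \<Rightarrow> ('a \<times> bool) list set \<Rightarrow> ('a \<Rightarrow> 'a)" where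
  "perm_hom X r A = the_elem (perm_word X r ` A)"

definition perm_group ::
  "'a set \<Rightarrow> ('a \<times> 'a \<Rightarrow> 'a \<times> 'a) \<Rightarrow> ('a \<Rightarrow> 'a) monoid" where
  "perm_group X r = (BijGroup X)\<lparr>carrier := perm_hom X r ` carrier (structure_group X r)\<rparr>"

text \<open>Elements of the free algebra $\mathbf{k}\langle X\rangle$ are finitely supported
  functions on words, and the algebra $A(\mathbf{k},X,r)$ is its quotient by the two-sided ideal
  generated by the differences $v - w$ of the defining relations, that is, by the linear span of
  all $u(v - w)u'$ with words $u, u'$.\<close>

definition free_algebra :: "'a set \<Rightarrow> ('a list \<Rightarrow>\<^sub>0 'k::field) set" where
  "free_algebra X = {f. Poly_Mapping.keys f \<subseteq> lists X}"

inductive_set relation_ideal ::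
  "'a set \<Rightarrow> ('a \<times> 'a \<Rightarrow> 'a \<times> 'a) \<Rightarrow> ('a list \<Rightarrow>\<^sub>0 'k::field) set"
  for X r where
  zero: "0 \<in> relation_ideal X r"
| add: "f \<in> relation_ideal X r \<Longrightarrow> u \<in> lists X \<Longrightarrow> u' \<in> lists X \<Longrightarrow> (v, w) \<in> relators X r \<Longrightarrow>
    f + (Poly_Mapping.single (u @ v @ u') c - Poly_Mapping.single (u @ w @ u') c)
      \<in> relation_ideal X r"


section \<open>Admissible enumerations\<close>

text \<open>An enumeration of $X$ is a list \<open>xs\<close>; indices start at 0. The word
  $x_1^{\alpha_1}\cdots x_n^{\alpha_n}$:\<close>

definition ordered_word :: "'a list \<Rightarrow> (nat \<Rightarrow> nat) \<Rightarrow> 'a list" where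
  "ordered_word xs \<alpha> = concat (map (\<lambda>i. replicate (\<alpha> i) (xs ! i)) [0..<length xs])"

text \<open>As $r$ is involutive, \<open>relators X r\<close> contains each equation $v = w$ in both
  orientations; for counting, an equation is therefore regarded as the unordered pair
  \<open>{v, w}\<close>. The map \<open>\<phi>\<close> sends $(i,j)$ to $(i',j')$. The last conjunct
  says that the ordered words form a $\mathbf{k}$-basis of the algebra: every element of the algebra is a
  linear combination of them in exactly one way.\<close>

definition admissible ::
  "'k::field itself \<Rightarrow> 'a set \<Rightarrow> ('a \<times> 'a \<Rightarrow> 'a \<times> 'a) \<Rightarrow> 'a list \<Rightarrow> bool" where
  "admissible _ X r xs \<longleftrightarrow>
     distinct xs \<and> set xs = X \<and>
     (let n = length xs;
          P = {(i, j). i < j \<and> j < n};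
          eqs = (\<lambda>(v, w). {v, w}) ` relators X r
      in card eqs = n choose 2 \<and>
         (\<exists>\<phi>. (\<forall>(i, j)\<in>P. \<phi> (i, j) \<in> P \<and> fst (\<phi> (i, j)) < j) \<and>
              eqs = (\<lambda>(i, j). {[xs ! j, xs ! i],
                               [xs ! fst (\<phi> (i, j)), xs ! snd (\<phi> (i, j))]}) ` P \<and>
              (\<forall>q\<in>P. \<exists>q'\<in>P. \<phi> q' = q))) \<and>
     (\<forall>f\<in>free_algebra X. \<exists>!g :: 'a list \<Rightarrow>\<^sub>0 'k.
         Poly_Mapping.keys g \<subseteq> range (ordered_word xs) \<and> f - g \<in> relation_ideal X r)"

definition bounded_monomials ::
  "'a set \<Rightarrow> ('a \<times> 'a \<Rightarrow> 'a \<times> 'a) \<Rightarrow> 'a list \<Rightarrow> nat \<Rightarrow> ('a \<times> bool) list set set" where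
  "bounded_monomials X r xs p =
     {word_elt X r (ordered_word xs \<alpha>) | \<alpha>. \<forall>i<length xs. \<alpha> i \<le> p - 1}"

definition power_subgroup ::
  "'a set \<Rightarrow> ('a \<times> 'a \<Rightarrow> 'a \<times> 'a) \<Rightarrow> nat \<Rightarrow> ('a \<times> bool) list set set" where
  "power_subgroup X r p =
     generate (structure_group X r) ((\<lambda>x. gen X r x [^]\<^bsub>structure_group X r\<^esub> p) ` X)"


section \<open>Braided groups\<close>

locale braided_group = group G for G (structure) +
  fixes \<sigma> :: "'a \<times> 'a \<Rightarrow> 'a \<times> 'a"
  assumes sigma_bij: "bij_betw \<sigma> (carrier G \<times> carrier G) (carrier G \<times> carrier G)"
    and lact_one: "a \<in> carrier G \<Longrightarrow> lact \<sigma> a \<one> = \<one>"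
    and one_lact: "u \<in> carrier G \<Longrightarrow> lact \<sigma> \<one> u = u"
    and mult_lact: "\<lbrakk>a \<in> carrier G; b \<in> carrier G; u \<in> carrier G\<rbrakk> \<Longrightarrow>
      lact \<sigma> (a \<otimes> b) u = lact \<sigma> a (lact \<sigma> b u)"
    and lact_mult: "\<lbrakk>a \<in> carrier G; u \<in> carrier G; v \<in> carrier G\<rbrakk> \<Longrightarrow>
      lact \<sigma> a (u \<otimes> v) = lact \<sigma> a u \<otimes> lact \<sigma> (ract \<sigma> a u) v"
    and one_ract: "u \<in> carrier G \<Longrightarrow> ract \<sigma> \<one> u = \<one>"
    and ract_one: "a \<in> carrier G \<Longrightarrow> ract \<sigma> a \<one> = a"
    and ract_mult: "\<lbrakk>a \<in> carrier G; u \<in> carrier G; v \<in> carrier G\<rbrakk> \<Longrightarrow>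
      ract \<sigma> a (u \<otimes> v) = ract \<sigma> (ract \<sigma> a u) v"
    and mult_ract: "\<lbrakk>a \<in> carrier G; b \<in> carrier G; u \<in> carrier G\<rbrakk> \<Longrightarrow>
      ract \<sigma> (a \<otimes> b) u = ract \<sigma> a (lact \<sigma> b u) \<otimes> ract \<sigma> b u"
    and braided_comm: "\<lbrakk>u \<in> carrier G; v \<in> carrier G\<rbrakk> \<Longrightarrow>
      u \<otimes> v = lact \<sigma> u v \<otimes> ract \<sigma> u v"

locale involutive_braided_group = braided_group +
  assumes sigma_invol: "involutive_on (carrier G) \<sigma>"

definition braided_hom ::
  "('a, 'c) monoid_scheme \<Rightarrow> ('a \<times> 'a \<Rightarrow> 'a \<times> 'a) \<Rightarrow>
   ('b, 'd) monoid_scheme \<Rightarrow> ('b \<times> 'b \<Rightarrow> 'b \<times> 'b) \<Rightarrow> ('a \<Rightarrow> 'b) \<Rightarrow> bool" where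
  "braided_hom G \<sigma> H \<tau> f \<longleftrightarrow>
     braided_group G \<sigma> \<and> braided_group H \<tau> \<and> f \<in> hom G H \<and>
     (\<forall>a\<in>carrier G. \<forall>b\<in>carrier G. map_prod f f (\<sigma> (a, b)) = \<tau> (f a, f b))"

definition braided_epi ::
  "('a, 'c) monoid_scheme \<Rightarrow> ('a \<times> 'a \<Rightarrow> 'a \<times> 'a) \<Rightarrow>
   ('b, 'd) monoid_scheme \<Rightarrow> ('b \<times> 'b \<Rightarrow> 'b \<times> 'b) \<Rightarrow> ('a \<Rightarrow> 'b) \<Rightarrow> bool" where
  "braided_epi G \<sigma> H \<tau> f \<longleftrightarrow> braided_hom G \<sigma> H \<tau> f \<and> f ` carrier G = carrier H"

text \<open>The braiding of the group $G(X,r)$ associated to a solution; it is unique on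
  \<open>carrier G \<times> carrier G\<close>.\<close>

definition associated_braiding ::
  "'a set \<Rightarrow> ('a \<times> 'a \<Rightarrow> 'a \<times> 'a) \<Rightarrow>
   (('a \<times> bool) list set \<times> ('a \<times> bool) list set \<Rightarrow>
    ('a \<times> bool) list set \<times> ('a \<times> bool) list set) \<Rightarrow> bool" where
  "associated_braiding X r \<sigma> \<longleftrightarrow>
     involutive_braided_group (structure_group X r) \<sigma> \<and>
     (\<forall>x\<in>X. \<forall>y\<in>X. \<sigma> (gen X r x, gen X r y) = map_prod (gen X r) (gen X r) (r (x, y)))"

definition braided_ideal ::
  "('a, 'c) monoid_scheme \<Rightarrow> ('a \<times> 'a \<Rightarrow> 'a \<times> 'a) \<Rightarrow> 'a set \<Rightarrow> bool" where
  "braided_ideal G \<sigma> H \<longleftrightarrow> H \<lhd> G \<and> (\<forall>g\<in>carrier G. \<forall>h\<in>H. lact \<sigma> g h \<in> H)"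

definition socle ::
  "('a, 'c) monoid_scheme \<Rightarrow> ('a \<times> 'a \<Rightarrow> 'a \<times> 'a) \<Rightarrow> 'a set" where
  "socle G \<sigma> = {a \<in> carrier G. \<forall>u\<in>carrier G. lact \<sigma> a u = u}"

text \<open>The braiding induced on \<open>G Mod H\<close>. Each union is taken over all representatives of
  the two cosets; for an ideal \<open>H\<close> all its members are the same coset.\<close>

definition quotient_braiding ::
  "('a, 'c) monoid_scheme \<Rightarrow> ('a \<times> 'a \<Rightarrow> 'a \<times> 'a) \<Rightarrow> 'a set \<Rightarrow>
   'a set \<times> 'a set \<Rightarrow> 'a set \<times> 'a set" where
  "quotient_braiding G \<sigma> H =
     (\<lambda>(A, B). (\<Union>a\<in>A. \<Union>b\<in>B. H #>\<^bsub>G\<^esub> lact \<sigma> a b, \<Union>a\<in>A. \<Union>b\<in>B. H #>\<^bsub>G\<^esub> ract \<sigma> a b))"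

text \<open>The map on cosets induced by $\mathcal{L}$, which for the cosets of the socle is the
  isomorphism $G/\Gamma \simeq \mathcal{G}$, and the braiding on $\mathcal{G}$ transported along
  this isomorphism.\<close>

definition induced_perm ::
  "'a set \<Rightarrow> ('a \<times> 'a \<Rightarrow> 'a \<times> 'a) \<Rightarrow> ('a \<times> bool) list set set \<Rightarrow> ('a \<Rightarrow> 'a)" where
  "induced_perm X r A = the_elem (perm_hom X r ` A)"

definition perm_braiding ::
  "'a set \<Rightarrow> ('a \<times> 'a \<Rightarrow> 'a \<times> 'a) \<Rightarrow>
   (('a \<times> bool) list set \<times> ('a \<times> bool) list set \<Rightarrow>
    ('a \<times> bool) list set \<times> ('a \<times> bool) list set) \<Rightarrow>
   ('a \<Rightarrow> 'a) \<times> ('a \<Rightarrow> 'a) \<Rightarrow> ('a \<Rightarrow> 'a) \<times> ('a \<Rightarrow> 'a)" where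
  "perm_braiding X r \<sigma> =
     (let G = structure_group X r;
          \<Gamma> = socle G \<sigma>;
          \<phi> = induced_perm X r;
          \<psi> = inv_into (carrier (G Mod \<Gamma>)) \<phi>
      in (\<lambda>fg. map_prod \<phi> \<phi> (quotient_braiding G \<sigma> \<Gamma> (map_prod \<psi> \<psi> fg))))"

definition p_group :: "nat \<Rightarrow> ('a, 'c) monoid_scheme \<Rightarrow> bool" where
  "p_group p G \<longleftrightarrow> group G \<and> (\<forall>g\<in>carrier G. \<exists>k. group.ord G g = p ^ k)"

end

theory Submission
  imports Defs
begin

text \<open>The map sending \<open>x\<close> to the affine map \<open>v \<mapsto> e\<^sub>x + \<L>\<^sub>x v\<close> of the functions \<open>X \<rightarrow> \<int>\<close> respects the
  defining relations, so \<open>G\<close> acts on these functions; the orbit map of \<open>0\<close> is a 1-cocycle sending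
  \<open>x\<close> to \<open>e\<^sub>x\<close>. Hence \<open>X\<close> embeds into \<open>G\<close>, and \<open>\<Gamma>\<close> is the kernel of \<open>\<L>\<close>. As \<open>X\<close> is square-free,
  \<open>x\<^sup>p\<close> acts as translation by \<open>p e\<^sub>x\<close> and \<open>g x\<^sup>p g\<inverse> = (\<L>\<^sub>g x)\<^sup>p\<close>, so \<open>F\<^sub>p\<close> is an ideal inside \<open>\<Gamma>\<close>, and
  the cocycle modulo \<open>p\<close> is constant on cosets of \<open>F\<^sub>p\<close> and attains all \<open>p\<^sup>n\<close> values. Conversely
  \<open>x\<inverse>\<close> and \<open>x\<^sup>p\<^sup>-\<^sup>1\<close> agree modulo \<open>F\<^sub>p\<close>, so every coset contains a positive word, hence an ordered one,
  hence an element of \<open>Y\<close>, which has at most \<open>p\<^sup>n\<close> elements. Counting makes \<open>Y\<close> a transversal.\<close>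

section \<open>The structure group and its universal property\<close>

text \<open>\<open>perm_word\<close> with an arbitrary target group \<open>H\<close>, so that one
  construction yields both \<L> and the affine action.\<close>

definition word_eval ::
  "('b, 'c) monoid_scheme \<Rightarrow> ('a \<Rightarrow> 'b) \<Rightarrow> ('a \<times> bool) list \<Rightarrow> 'b" where
  "word_eval H f w =
     foldr (\<lambda>(x, b) g. (if b then f x else inv\<^bsub>H\<^esub> (f x)) \<otimes>\<^bsub>H\<^esub> g) w \<one>\<^bsub>H\<^esub>"

definition structure_lift ::
  "('b, 'c) monoid_scheme \<Rightarrow> ('a \<Rightarrow> 'b) \<Rightarrow> ('a \<times> bool) list set \<Rightarrow> 'b" where
  "structure_lift H f A = the_elem (word_eval H f ` A)"

lemma word_eval_Nil [simp]: "word_eval H f [] = \<one>\<^bsub>H\<^esub>"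
  by (simp add: word_eval_def)

lemma word_eval_Cons [simp]:
  "word_eval H f ((x, b) # w) = (if b then f x else inv\<^bsub>H\<^esub> (f x)) \<otimes>\<^bsub>H\<^esub> word_eval H f w"
  by (simp add: word_eval_def)

locale quadratic_set =
  fixes X :: "'a set" and r :: "'a \<times> 'a \<Rightarrow> 'a \<times> 'a"
  assumes r_closed: "\<lbrakk>x \<in> X; y \<in> X\<rbrakk> \<Longrightarrow> r (x, y) \<in> X \<times> X"
begin

abbreviation "signed_words \<equiv> lists (X \<times> (UNIV :: bool set))"
abbreviation "SG \<equiv> structure_group X r"

lemma relators_lists: "(a, c) \<in> relators X r \<Longrightarrow> a \<in> lists X \<and> c \<in> lists X"
  using r_closed by (fastforce simp: relators_def)

lemma positive_words: "w \<in> lists X \<Longrightarrow> map (\<lambda>x. (x, True)) w \<in> signed_words"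
  by (induction w) auto

lemma gcong_words: "gcong X r v w \<Longrightarrow> v \<in> signed_words \<and> w \<in> signed_words"
proof (induction rule: gcong.induct)
  case (rel u v a c)
  then show ?case
    using relators_lists[OF rel(3)] positive_words by (simp del: in_lists_conv_set lists_image)
qed auto

lemma gcong_prefix:
  assumes "gcong X r v w" "u \<in> signed_words"
  shows "gcong X r (u @ v) (u @ w)"
  using assms
proof (induction rule: gcong.induct)
  case (refl w)
  then show ?case by (intro gcong.refl) auto
next
  case (cancel u' v x b)
  then show ?case using gcong.cancel[of "u @ u'" X v x r b] by simp
next
  case (rel u' v a c)
  then show ?case using gcong.rel[of "u @ u'" X v a c r] by simp
next
  case (sym v w)
  then show ?case using gcong.sym by simp
next
  case (trans v w z)
  then show ?case by (metis gcong.trans)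
qed

lemma gcong_suffix:
  assumes "gcong X r v w" "u \<in> signed_words"
  shows "gcong X r (v @ u) (w @ u)"
  using assms
proof (induction rule: gcong.induct)
  case (refl w)
  then show ?case by (intro gcong.refl) auto
next
  case (cancel u' v x b)
  then show ?case using gcong.cancel[of "u'" X "v @ u" x r b] by simp
next
  case (rel u' v a c)
  then show ?case using gcong.rel[of "u'" X "v @ u" a c r] by simp
next
  case (sym v w)
  then show ?case using gcong.sym by simp
next
  case (trans v w z)
  then show ?case by (metis gcong.trans)
qed

lemma gcong_append:
  assumes "gcong X r u u'" "gcong X r v v'"
  shows "gcong X r (u @ v) (u' @ v')"
  using gcong_suffix[OF assms(1), of v] gcong_prefix[OF assms(2), of u'] assms gcong_words
  by (meson gcong.trans)

lemma gclass_self: "w \<in> signed_words \<Longrightarrow> w \<in> gclass X r w"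
  by (simp add: gclass_def gcong.refl del: in_lists_conv_set)

lemma gclass_eqI: "gcong X r v w \<Longrightarrow> gclass X r v = gclass X r w"
  unfolding gclass_def using gcong.sym[of X r v w] gcong.trans[of X r] by (intro Collect_cong) metis

lemma SG_carrier: "carrier SG = gclass X r ` signed_words"
  by (simp add: structure_group_def)

lemma SG_one: "\<one>\<^bsub>SG\<^esub> = gclass X r []"
  by (simp add: structure_group_def)

text \<open>The product of \<open>structure_group\<close> collects every word congruent to a
  concatenation of representatives; compatibility of the congruence with concatenation makes this
  set a single class.\<close>

lemma SG_mult:
  assumes "u \<in> signed_words" "v \<in> signed_words"
  shows "gclass X r u \<otimes>\<^bsub>SG\<^esub> gclass X r v = gclass X r (u @ v)"
proof -
  have "(\<exists>u'\<in>gclass X r u. \<exists>v'\<in>gclass X r v. gcong X r (u' @ v') w) \<longleftrightarrow> gcong X r (u @ v) w" for w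
  proof
    assume "\<exists>u'\<in>gclass X r u. \<exists>v'\<in>gclass X r v. gcong X r (u' @ v') w"
    then show "gcong X r (u @ v) w"
      unfolding gclass_def using gcong.trans gcong_append by (metis mem_Collect_eq)
  qed (use assms gclass_self in blast)
  then show ?thesis by (simp add: structure_group_def gclass_def)
qed

lemma gclass_letter_cancel:
  assumes "x \<in> X"
  shows "gclass X r [(x, b)] \<otimes>\<^bsub>SG\<^esub> gclass X r [(x, \<not> b)] = \<one>\<^bsub>SG\<^esub>"
proof -
  have "gcong X r ([] @ [(x, b), (x, \<not> b)] @ []) ([] @ [])"
    by (rule gcong.cancel) (use assms in auto)
  then show ?thesis using assms by (simp add: SG_mult SG_one gclass_eqI)
qed

text \<open>The inverse word grows at its right end, by the first letter of \<open>w\<close> with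
  flipped sign, so that these two letters meet and cancel.\<close>

lemma gclass_inverse:
  assumes "w \<in> signed_words"
  shows "\<exists>v\<in>signed_words. gcong X r (v @ w) []"
  using assms
proof (induction w)
  case Nil
  then show ?case using gcong.refl[of "[]" X r] by auto
next
  case (Cons a w)
  obtain x b where a: "a = (x, b)" by force
  obtain v where v: "v \<in> signed_words" "gcong X r (v @ w) []" using Cons by auto
  \<comment> \<open>The sign \<open>b\<close> is written as \<open>\<not> \<not> b\<close> to fit
    the shape of \<open>gcong.cancel\<close>.\<close>
  have "gcong X r (v @ [(x, \<not> b), (x, \<not> \<not> b)] @ w) (v @ w)"
    by (rule gcong.cancel) (use v Cons a in auto)
  then have "gcong X r ((v @ [(x, \<not> b)]) @ a # w) []"
    using v(2) a by (simp add: gcong.trans[of X r _ "v @ w"])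
  moreover have "v @ [(x, \<not> b)] \<in> signed_words" using v Cons a by auto
  ultimately show ?case by blast
qed

lemma SG_group: "group SG"
proof (rule groupI)
  fix A B assume "A \<in> carrier SG" "B \<in> carrier SG"
  then show "A \<otimes>\<^bsub>SG\<^esub> B \<in> carrier SG"
    unfolding SG_carrier using SG_mult by (elim imageE) (simp only: append_in_lists_conv imageI)
next
  show "\<one>\<^bsub>SG\<^esub> \<in> carrier SG" by (simp add: SG_one SG_carrier)
next
  fix A B C assume "A \<in> carrier SG" "B \<in> carrier SG" "C \<in> carrier SG"
  then obtain u v w where "u \<in> signed_words" "v \<in> signed_words" "w \<in> signed_words"
    "A = gclass X r u" "B = gclass X r v" "C = gclass X r w"
    unfolding SG_carrier by blast
  then show "A \<otimes>\<^bsub>SG\<^esub> B \<otimes>\<^bsub>SG\<^esub> C = A \<otimes>\<^bsub>SG\<^esub> (B \<otimes>\<^bsub>SG\<^esub> C)"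
    by (simp add: SG_mult del: in_lists_conv_set)
next
  fix A assume "A \<in> carrier SG"
  then obtain w where w: "w \<in> signed_words" "A = gclass X r w" by (auto simp: SG_carrier)
  show "\<one>\<^bsub>SG\<^esub> \<otimes>\<^bsub>SG\<^esub> A = A"
    using w SG_mult[of "[]" w] by (simp add: SG_one)
  obtain v where v: "v \<in> signed_words" "gcong X r (v @ w) []" using gclass_inverse w by blast
  have "gclass X r v \<otimes>\<^bsub>SG\<^esub> A = \<one>\<^bsub>SG\<^esub>"
    using v w gclass_eqI[OF v(2)] by (simp only: SG_mult SG_one)
  then show "\<exists>B\<in>carrier SG. B \<otimes>\<^bsub>SG\<^esub> A = \<one>\<^bsub>SG\<^esub>"
    using v by (auto simp: SG_carrier simp del: in_lists_conv_set)
qed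

sublocale SG: group SG by (rule SG_group)

lemma gen_eq: "gen X r x = gclass X r [(x, True)]"
  by (simp add: gen_def word_elt_def)

lemma gen_closed: "x \<in> X \<Longrightarrow> gen X r x \<in> carrier SG"
  by (auto simp: gen_eq SG_carrier)

lemma inv_gen: "x \<in> X \<Longrightarrow> inv\<^bsub>SG\<^esub> gen X r x = gclass X r [(x, False)]"
  using gclass_letter_cancel[of x False] by (intro SG.inv_equality) (auto simp: gen_eq SG_carrier)

lemma word_elt_closed: "w \<in> lists X \<Longrightarrow> word_elt X r w \<in> carrier SG"
  unfolding word_elt_def SG_carrier by (intro imageI positive_words)

lemma word_elt_Nil [simp]: "word_elt X r [] = \<one>\<^bsub>SG\<^esub>"
  by (simp add: word_elt_def SG_one)

lemma word_elt_append:
  "\<lbrakk>v \<in> lists X; w \<in> lists X\<rbrakk> \<Longrightarrow>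
    word_elt X r (v @ w) = word_elt X r v \<otimes>\<^bsub>SG\<^esub> word_elt X r w"
  unfolding word_elt_def map_append by (intro SG_mult[symmetric] positive_words)

lemma word_elt_Cons:
  "\<lbrakk>x \<in> X; w \<in> lists X\<rbrakk> \<Longrightarrow> word_elt X r (x # w) = gen X r x \<otimes>\<^bsub>SG\<^esub> word_elt X r w"
  using word_elt_append[of "[x]" w] by (simp add: gen_def)

lemma word_elt_replicate:
  assumes "x \<in> X"
  shows "word_elt X r (replicate k x) = gen X r x [^]\<^bsub>SG\<^esub> k"
proof (induction k)
  case (Suc k)
  have "replicate k x \<in> lists X" using assms by auto
  then show ?case
    using assms Suc SG.nat_pow_Suc2[OF gen_closed] by (simp add: word_elt_Cons)
qed simp

lemma word_elt_rel:
  assumes "u \<in> lists X" "u' \<in> lists X" "(v, w) \<in> relators X r"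
  shows "word_elt X r (u @ v @ u') = word_elt X r (u @ w @ u')"
  unfolding word_elt_def map_append
  by (intro gclass_eqI gcong.rel assms positive_words)

text \<open>Peeling letters off the left end of a signed word reduces a claim about \<open>G\<close>
  to left multiplication by a generator or its inverse.\<close>

lemma SG_induct [consumes 1, case_names one gen inv_gen]:
  assumes "g \<in> carrier SG"
    and "P \<one>\<^bsub>SG\<^esub>"
    and "\<And>x g. \<lbrakk>x \<in> X; g \<in> carrier SG; P g\<rbrakk> \<Longrightarrow> P (gen X r x \<otimes>\<^bsub>SG\<^esub> g)"
    and "\<And>x g. \<lbrakk>x \<in> X; g \<in> carrier SG; P g\<rbrakk> \<Longrightarrow> P (inv\<^bsub>SG\<^esub> gen X r x \<otimes>\<^bsub>SG\<^esub> g)"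
  shows "P g"
proof -
  have "P (gclass X r w)" if "w \<in> signed_words" for w
    using that
  proof (induction w)
    case Nil
    then show ?case using assms(2) by (simp add: SG_one)
  next
    case (Cons a w)
    obtain x b where a: "a = (x, b)" by force
    have x: "x \<in> X" and w: "w \<in> signed_words" using Cons a by auto
    then have "gclass X r (a # w) = gclass X r [(x, b)] \<otimes>\<^bsub>SG\<^esub> gclass X r w"
      using SG_mult[of "[(x, b)]" w] a by simp
    moreover have "gclass X r w \<in> carrier SG" using w unfolding SG_carrier by blast
    moreover have "P (gclass X r w)" using Cons by blast
    ultimately show ?case
      using assms(3,4) x by (cases b) (auto simp: gen_eq[symmetric] inv_gen[symmetric])
  qed
  then show ?thesis using assms(1) by (auto simp: SG_carrier simp del: in_lists_conv_set)
qed

lemma SG_generated: "generate SG (gen X r ` X) = carrier SG"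
proof
  show "generate SG (gen X r ` X) \<subseteq> carrier SG"
    by (intro SG.generate_incl) (auto intro: gen_closed)
  show "carrier SG \<subseteq> generate SG (gen X r ` X)"
  proof
    fix g assume "g \<in> carrier SG"
    then show "g \<in> generate SG (gen X r ` X)"
      by (induction rule: SG_induct) (auto intro: generate.intros)
  qed
qed

end

section \<open>Homomorphisms from the structure group determined by their values on
  generators\<close>

locale structure_map = quadratic_set X r + H: group H
  for X :: "'a set" and r and H :: "('b, 'c) monoid_scheme" (structure) +
  fixes f :: "'a \<Rightarrow> 'b"
  assumes f_closed: "x \<in> X \<Longrightarrow> f x \<in> carrier H"
    and f_rel: "\<lbrakk>x \<in> X; y \<in> X; r (x, y) = (z, t)\<rbrakk> \<Longrightarrow> f x \<otimes> f y = f z \<otimes> f t"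
begin

lemma word_eval_closed: "w \<in> signed_words \<Longrightarrow> word_eval H f w \<in> carrier H"
  by (induction w) (auto simp: f_closed)

lemma word_eval_append:
  "\<lbrakk>v \<in> signed_words; w \<in> signed_words\<rbrakk> \<Longrightarrow>
    word_eval H f (v @ w) = word_eval H f v \<otimes> word_eval H f w"
proof (induction v)
  case (Cons a v)
  then have "word_eval H f v \<in> carrier H" "word_eval H f w \<in> carrier H"
    using word_eval_closed by (metis Cons_in_lists_iff)+
  then show ?case using Cons by (cases a) (auto simp: f_closed H.m_assoc)
qed (simp add: word_eval_closed del: in_lists_conv_set)

lemma word_eval_gcong: "gcong X r v w \<Longrightarrow> word_eval H f v = word_eval H f w"
proof (induction rule: gcong.induct)
  case (cancel u v x b)
  then have "[(x, b), (x, \<not> b)] @ v \<in> signed_words" by auto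
  moreover have "word_eval H f ([(x, b), (x, \<not> b)] @ v) = word_eval H f v"
    using cancel word_eval_closed[OF cancel(2)] f_closed[OF cancel(3)]
    by (simp add: H.m_assoc[symmetric])
  ultimately show ?case using cancel by (simp add: word_eval_append del: in_lists_conv_set)
next
  case (rel u v a c)
  obtain x y z t where *: "x \<in> X" "y \<in> X" "r (x, y) = (z, t)" "a = [x, y]" "c = [z, t]"
    using rel(3) by (auto simp: relators_def)
  then have zt: "z \<in> X" "t \<in> X" using r_closed by force+
  let ?a = "map (\<lambda>x. (x, True)) a" and ?c = "map (\<lambda>x. (x, True)) c"
  have words: "?a \<in> signed_words" "?c \<in> signed_words" using * zt by auto
  have "word_eval H f ?a = word_eval H f ?c"
    using * zt f_rel[OF *(1-3)] by (simp add: f_closed)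
  then show ?case using rel(1,2) words
    by (metis append_in_lists_conv word_eval_append)
qed auto

text \<open>Congruent words have equal values, so a class has a singleton image and
  \<open>the_elem\<close> extracts its element.\<close>

lemma structure_lift_gclass:
  assumes "w \<in> signed_words"
  shows "structure_lift H f (gclass X r w) = word_eval H f w"
proof -
  have "word_eval H f ` gclass X r w = {word_eval H f w}"
  proof (intro equalityI subsetI)
    fix h assume "h \<in> word_eval H f ` gclass X r w"
    then show "h \<in> {word_eval H f w}"
      using word_eval_gcong[of w] by (auto simp: gclass_def)
  qed (use gclass_self[OF assms] in simp)
  then show ?thesis by (simp add: structure_lift_def)
qed

lemma structure_lift_hom: "structure_lift H f \<in> hom SG H"
proof (rule homI)
  fix A assume "A \<in> carrier SG"
  then show "structure_lift H f A \<in> carrier H"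
    unfolding SG_carrier by (elim imageE) (simp only: structure_lift_gclass word_eval_closed)
next
  fix A B assume "A \<in> carrier SG" "B \<in> carrier SG"
  then obtain v w where "v \<in> signed_words" "w \<in> signed_words" "A = gclass X r v" "B = gclass X r w"
    unfolding SG_carrier by blast
  then show "structure_lift H f (A \<otimes>\<^bsub>SG\<^esub> B) = structure_lift H f A \<otimes> structure_lift H f B"
    using structure_lift_gclass[of "v @ w"]
    by (simp add: SG_mult structure_lift_gclass word_eval_append del: in_lists_conv_set)
qed

lemma structure_lift_gen: "x \<in> X \<Longrightarrow> structure_lift H f (gen X r x) = f x"
  using structure_lift_gclass[of "[(x, True)]"] f_closed by (simp add: gen_eq)

end

section \<open>Involutive braided groups and their quotients\<close>

context braided_group
begin

lemma lact_closed [simp]: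
  "\<lbrakk>a \<in> carrier G; u \<in> carrier G\<rbrakk> \<Longrightarrow> lact \<sigma> a u \<in> carrier G"
  using bij_betwE[OF sigma_bij] by (force simp: lact_def mem_Times_iff)

lemma ract_closed [simp]:
  "\<lbrakk>a \<in> carrier G; u \<in> carrier G\<rbrakk> \<Longrightarrow> ract \<sigma> a u \<in> carrier G"
  using bij_betwE[OF sigma_bij] by (force simp: ract_def mem_Times_iff)

lemma sigma_eq: "\<sigma> (a, u) = (lact \<sigma> a u, ract \<sigma> a u)"
  by (simp add: lact_def ract_def)

lemma lact_inv_lact [simp]:
  "\<lbrakk>a \<in> carrier G; u \<in> carrier G\<rbrakk> \<Longrightarrow> lact \<sigma> (inv a) (lact \<sigma> a u) = u"
  by (metis inv_closed l_inv mult_lact one_lact)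

lemma lact_lact_inv [simp]:
  "\<lbrakk>a \<in> carrier G; u \<in> carrier G\<rbrakk> \<Longrightarrow> lact \<sigma> a (lact \<sigma> (inv a) u) = u"
  by (metis inv_closed r_inv mult_lact one_lact)

lemma lact_inj:
  "\<lbrakk>a \<in> carrier G; u \<in> carrier G; v \<in> carrier G; lact \<sigma> a u = lact \<sigma> a v\<rbrakk> \<Longrightarrow> u = v"
  by (metis lact_inv_lact)

text \<open>Braided commutativity expresses the right action through the left action and the
  product.\<close>

lemma ract_eq:
  "\<lbrakk>a \<in> carrier G; u \<in> carrier G\<rbrakk> \<Longrightarrow> ract \<sigma> a u = inv (lact \<sigma> a u) \<otimes> a \<otimes> u"
  using braided_comm[of a u] by (simp add: m_assoc inv_solve_left)

lemma socle_subset: "socle G \<sigma> \<subseteq> carrier G"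
  by (auto simp: socle_def)

lemma socle_lact: "\<lbrakk>a \<in> socle G \<sigma>; u \<in> carrier G\<rbrakk> \<Longrightarrow> lact \<sigma> a u = u"
  by (simp add: socle_def)

lemma socle_normal: "socle G \<sigma> \<lhd> G"
proof (rule normal_invI)
  show "subgroup (socle G \<sigma>) G"
  proof (rule subgroupI)
    fix a assume a: "a \<in> socle G \<sigma>"
    then have "lact \<sigma> (inv a) u = u" if "u \<in> carrier G" for u
      using that lact_inv_lact[of a u] socle_subset by (auto simp: socle_lact)
    then show "inv a \<in> socle G \<sigma>" using a by (simp add: socle_def)
  next
    fix a b assume "a \<in> socle G \<sigma>" "b \<in> socle G \<sigma>"
    then show "a \<otimes> b \<in> socle G \<sigma>" by (simp add: socle_def mult_lact)
  qed (auto simp: socle_def one_lact intro: exI[of _ "\<one>"])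
next
  fix g a assume "g \<in> carrier G" "a \<in> socle G \<sigma>"
  then show "g \<otimes> a \<otimes> inv g \<in> socle G \<sigma>"
    by (simp add: socle_def mult_lact)
qed

end

context involutive_braided_group
begin

lemma lact_lact_ract:
  "\<lbrakk>a \<in> carrier G; u \<in> carrier G\<rbrakk> \<Longrightarrow> lact \<sigma> (lact \<sigma> a u) (ract \<sigma> a u) = a"
  using sigma_invol unfolding involutive_on_def
  by (metis SigmaI fst_conv lact_def prod.collapse ract_def)

text \<open>As \<sigma> is an involution, \<open>lact \<sigma> a u\<close> acting on
  \<open>ract \<sigma> a u\<close> returns \<open>a\<close>; undoing this action isolates the right
  action. In this form stability under the left action carries over to the right action.\<close>

lemma ract_eq_lact:
  "\<lbrakk>a \<in> carrier G; u \<in> carrier G\<rbrakk> \<Longrightarrow> ract \<sigma> a u = lact \<sigma> (inv (lact \<sigma> a u)) a"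
  using lact_inv_lact[of "lact \<sigma> a u" "ract \<sigma> a u"] lact_lact_ract[of a u] by simp

text \<open>As \<open>a\<close> acts trivially on \<open>inv g\<close>, the element
  \<open>ract \<sigma> a (inv g)\<close> equals \<open>lact \<sigma> g a\<close> by
  \<open>ract_eq_lact\<close> and the conjugate of \<open>a\<close> by \<open>ract_eq\<close>. Hence
  the left action on the socle is conjugation.\<close>

lemma lact_socle:
  assumes a: "a \<in> socle G \<sigma>" and g: "g \<in> carrier G"
  shows "lact \<sigma> g a = g \<otimes> a \<otimes> inv g"
  using ract_eq_lact[of a "inv g"] ract_eq[of a "inv g"] socle_lact[OF a, of "inv g"] socle_subset a g
  by auto

lemma socle_ideal: "braided_ideal G \<sigma> (socle G \<sigma>)"
  unfolding braided_ideal_def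
  using socle_normal lact_socle normal.inv_op_closed2[OF socle_normal] by simp

end

text \<open>Each axiom is an identity between products and the two actions, so a surjection
  compatible with the maps \<sigma> and \<tau> carries it over. This serves both for quotients by
  ideals and for the permutation group.\<close>

lemma (in involutive_braided_group) braided_image:
  assumes K: "group K" and f: "f \<in> hom G K" and onto: "f ` carrier G = carrier K"
    and compat: "\<And>a b. \<lbrakk>a \<in> carrier G; b \<in> carrier G\<rbrakk> \<Longrightarrow>
      \<tau> (f a, f b) = map_prod f f (\<sigma> (a, b))"
  shows "involutive_braided_group K \<tau> \<and> braided_epi G \<sigma> K \<tau> f"
proof -
  interpret K: group K by (rule K)
  have f_closed: "f a \<in> carrier K" if "a \<in> carrier G" for a using hom_in_carrier[OF f that] .
  have f_mult [simp]: "f a \<otimes>\<^bsub>K\<^esub> f b = f (a \<otimes> b)" if "a \<in> carrier G" "b \<in> carrier G" for a b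
    using hom_mult[OF f] that by simp
  have f_one: "\<one>\<^bsub>K\<^esub> = f \<one>" using hom_one[OF f is_group K] by simp
  have lactf [simp]: "lact \<tau> (f a) (f b) = f (lact \<sigma> a b)"
    and ractf [simp]: "ract \<tau> (f a) (f b) = f (ract \<sigma> a b)"
    if "a \<in> carrier G" "b \<in> carrier G" for a b
    using compat[OF that] by (auto simp: lact_def ract_def map_prod_def split: prod.splits)
  have K_E: "\<exists>a\<in>carrier G. k = f a" if "k \<in> carrier K" for k using that onto by blast
  have closed: "\<tau> p \<in> carrier K \<times> carrier K" and invol: "\<tau> (\<tau> p) = p"
    if p: "p \<in> carrier K \<times> carrier K" for p
  proof -
    obtain k l where kl: "p = (k, l)" "k \<in> carrier K" "l \<in> carrier K"
      using p by blast
    obtain a b where ab: "a \<in> carrier G" "b \<in> carrier G" "p = (f a, f b)"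
      using K_E[OF kl(2)] K_E[OF kl(3)] kl(1) by blast
    then show "\<tau> p \<in> carrier K \<times> carrier K"
      using f_closed by (simp add: compat sigma_eq)
    have "\<sigma> (\<sigma> (a, b)) = (a, b)" using sigma_invol ab by (auto simp: involutive_on_def)
    then show "\<tau> (\<tau> p) = p" using ab by (simp add: compat sigma_eq)
  qed
  \<comment> \<open>An involution preserving a set is its own inverse there.\<close>
  have bij: "bij_betw \<tau> (carrier K \<times> carrier K) (carrier K \<times> carrier K)"
    by (rule bij_betwI[where g = \<tau>]) (use closed invol in auto)
  have bg: "braided_group K \<tau>"
  proof (unfold_locales, goal_cases)
    case 1 show ?case by (rule bij)
  next
    case (2 a) then show ?case using K_E f_one by (metis lact_one lactf one_closed)
  next
    case (3 u) then show ?case using K_E f_one by (metis one_lact lactf one_closed)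
  next
    case (4 a b u)
    then obtain a' b' u' where "a' \<in> carrier G" "b' \<in> carrier G" "u' \<in> carrier G"
      "a = f a'" "b = f b'" "u = f u'" using K_E by meson
    then show ?case by (simp add: mult_lact)
  next
    case (5 a u v)
    then obtain a' u' v' where "a' \<in> carrier G" "u' \<in> carrier G" "v' \<in> carrier G"
      "a = f a'" "u = f u'" "v = f v'" using K_E by meson
    then show ?case by (simp add: lact_mult)
  next
    case (6 u) then show ?case using K_E f_one by (metis one_ract ractf one_closed)
  next
    case (7 a) then show ?case using K_E f_one by (metis ract_one ractf one_closed)
  next
    case (8 a u v)
    then obtain a' u' v' where "a' \<in> carrier G" "u' \<in> carrier G" "v' \<in> carrier G"
      "a = f a'" "u = f u'" "v = f v'" using K_E by meson
    then show ?case by (simp add: ract_mult)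
  next
    case (9 a b u)
    then obtain a' b' u' where "a' \<in> carrier G" "b' \<in> carrier G" "u' \<in> carrier G"
      "a = f a'" "b = f b'" "u = f u'" using K_E by meson
    then show ?case by (simp add: mult_ract)
  next
    case (10 u v)
    then obtain u' v' where "u' \<in> carrier G" "v' \<in> carrier G" "u = f u'" "v = f v'"
      using K_E by meson
    then show ?case by (simp add: braided_comm[symmetric])
  qed
  then have "involutive_braided_group K \<tau>"
    using invol by (auto simp: involutive_braided_group_def involutive_braided_group_axioms_def
      involutive_on_def)
  moreover have "braided_epi G \<sigma> K \<tau> f"
    unfolding braided_epi_def braided_hom_def
    using bg braided_group_axioms f onto compat by auto
  ultimately show ?thesis ..
qed

text \<open>Elements of \<open>M\<close> lift along the surjection \<open>q\<close>, and on lifts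
  \<open>f\<close> agrees with \<open>h\<close>, so the properties of \<open>h\<close>
  descend.\<close>

lemma braided_epi_factor:
  assumes h: "braided_epi G \<sigma> K \<tau> h" and q: "braided_epi G \<sigma> M \<mu> q"
    and fq: "\<And>g. g \<in> carrier G \<Longrightarrow> f (q g) = h g"
  shows "braided_epi M \<mu> K \<tau> f"
proof -
  have hD: "braided_group K \<tau>" "h \<in> hom G K" "h ` carrier G = carrier K"
      "\<And>a b. \<lbrakk>a \<in> carrier G; b \<in> carrier G\<rbrakk> \<Longrightarrow> map_prod h h (\<sigma> (a, b)) = \<tau> (h a, h b)"
    and qD: "braided_group G \<sigma>" "braided_group M \<mu>" "q \<in> hom G M" "q ` carrier G = carrier M"
      "\<And>a b. \<lbrakk>a \<in> carrier G; b \<in> carrier G\<rbrakk> \<Longrightarrow> map_prod q q (\<sigma> (a, b)) = \<mu> (q a, q b)"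
    using h q by (simp_all add: braided_epi_def braided_hom_def)
  interpret G: braided_group G \<sigma> by (rule qD)
  have M_E: "\<exists>a\<in>carrier G. k = q a" if "k \<in> carrier M" for k using that qD(4) by blast
  have onto: "f ` carrier M = carrier K"
    unfolding qD(4)[symmetric] hD(3)[symmetric] image_image using fq by simp
  have "f \<in> hom M K"
  proof (rule homI)
    fix A assume "A \<in> carrier M"
    then show "f A \<in> carrier K" using onto by blast
  next
    fix A B assume "A \<in> carrier M" "B \<in> carrier M"
    then obtain a b where ab: "a \<in> carrier G" "b \<in> carrier G" "A = q a" "B = q b"
      using M_E by meson
    then show "f (A \<otimes>\<^bsub>M\<^esub> B) = f A \<otimes>\<^bsub>K\<^esub> f B"
      using hom_mult[OF qD(3), of a b] hom_mult[OF hD(2), of a b] fq[of "a \<otimes>\<^bsub>G\<^esub> b"] fq by simp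
  qed
  moreover have "map_prod f f (\<mu> (A, B)) = \<tau> (f A, f B)"
    if AB: "A \<in> carrier M" "B \<in> carrier M" for A B
  proof -
    obtain a b where ab: "a \<in> carrier G" "b \<in> carrier G" "A = q a" "B = q b"
      using AB M_E by meson
    then show ?thesis
      using hD(4)[of a b] qD(5)[of a b, symmetric] by (simp add: G.sigma_eq fq)
  qed
  ultimately show ?thesis
    using onto hD(1) qD(2) by (simp add: braided_epi_def braided_hom_def)
qed

section \<open>Quotients of involutive braided groups by ideals\<close>

locale braided_quotient = involutive_braided_group G \<sigma>
  for G (structure) and \<sigma> +
  fixes H
  assumes ideal: "braided_ideal G \<sigma> H"
begin

sublocale H: normal H G using ideal by (simp add: braided_ideal_def)

lemma lact_ideal: "\<lbrakk>g \<in> carrier G; h \<in> H\<rbrakk> \<Longrightarrow> lact \<sigma> g h \<in> H"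
  using ideal by (simp add: braided_ideal_def)

lemma ract_ideal: "\<lbrakk>g \<in> carrier G; h \<in> H\<rbrakk> \<Longrightarrow> ract \<sigma> h g \<in> H"
  by (simp add: ract_eq_lact lact_ideal)

lemma coset_eq_iff:
  "\<lbrakk>a \<in> carrier G; b \<in> carrier G\<rbrakk> \<Longrightarrow> H #> a = H #> b \<longleftrightarrow> (\<exists>h\<in>H. a = h \<otimes> b)"
  using repr_independence[OF _ _ H.is_subgroup, of a b]
    repr_independenceD[OF H.is_subgroup, of a b]
  by (auto simp: r_coset_def[of _ _ b])

lemma coset_absorb: "\<lbrakk>h \<in> H; a \<in> carrier G\<rbrakk> \<Longrightarrow> H #> (h \<otimes> a) = H #> a"
  using coset_eq_iff[of "h \<otimes> a" a] by auto

lemma coset_mult_right: "\<lbrakk>h \<in> H; a \<in> carrier G\<rbrakk> \<Longrightarrow> H #> (a \<otimes> h) = H #> a"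
proof -
  assume h: "h \<in> H" and a: "a \<in> carrier G"
  have "a \<otimes> h = (a \<otimes> h \<otimes> inv a) \<otimes> a" using h a by (simp add: m_assoc)
  then show ?thesis using coset_absorb[OF H.inv_op_closed2[OF a h] a] by simp
qed

text \<open>In \<open>h \<otimes> u = lact \<sigma> h u \<otimes> ract \<sigma> h u\<close> the
  factors \<open>h\<close> and \<open>ract \<sigma> h u\<close> lie in \<open>H\<close> and
  disappear modulo \<open>H\<close>.\<close>

lemma coset_lact_left:
  assumes h: "h \<in> H" and u: "u \<in> carrier G"
  shows "H #> lact \<sigma> h u = H #> u"
proof -
  have "H #> (lact \<sigma> h u \<otimes> ract \<sigma> h u) = H #> (h \<otimes> u)"
    using braided_comm[of h u] h u by simp
  then show ?thesis using h u by (simp add: coset_absorb coset_mult_right ract_ideal)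
qed

lemma coset_ract_right:
  assumes h: "h \<in> H" and a: "a \<in> carrier G"
  shows "H #> ract \<sigma> a h = H #> a"
proof -
  have "H #> (lact \<sigma> a h \<otimes> ract \<sigma> a h) = H #> (a \<otimes> h)"
    using braided_comm[of a h] h a by simp
  then show ?thesis using h a by (simp add: coset_absorb coset_mult_right lact_ideal)
qed

text \<open>With \<open>a' = h \<otimes> a\<close> and \<open>b' = k \<otimes> b\<close>, the factor
  \<open>h\<close> acts trivially modulo \<open>H\<close>. Expanding the action of \<open>a\<close>
  on \<open>k \<otimes> b\<close> leaves a factor in \<open>H\<close> times the action of
  \<open>ract \<sigma> a k\<close> on \<open>b\<close>, and \<open>ract \<sigma> a k\<close> lies in
  the coset of \<open>a\<close>.\<close>

lemma coset_lact_cong: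
  assumes "a \<in> carrier G" "b \<in> carrier G" "a' \<in> H #> a" "b' \<in> H #> b"
  shows "H #> lact \<sigma> a' b' = H #> lact \<sigma> a b"
proof -
  obtain h k where hk: "h \<in> H" "k \<in> H" "a' = h \<otimes> a" "b' = k \<otimes> b"
    using assms by (auto simp: r_coset_def)
  have "H #> ract \<sigma> a k = H #> a" using coset_ract_right hk assms by simp
  then obtain l where l: "l \<in> H" "ract \<sigma> a k = l \<otimes> a"
    using coset_eq_iff[of "ract \<sigma> a k" a] hk assms by auto
  have "H #> lact \<sigma> a' b' = H #> lact \<sigma> a (k \<otimes> b)"
    using hk assms by (simp add: mult_lact coset_lact_left)
  also have "\<dots> = H #> lact \<sigma> (l \<otimes> a) b"
    using hk assms l by (simp add: lact_mult coset_absorb lact_ideal)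
  also have "\<dots> = H #> lact \<sigma> a b"
    using l assms by (simp add: mult_lact coset_lact_left)
  finally show ?thesis .
qed

lemma coset_mult_cong:
  assumes "a \<in> carrier G" "b \<in> carrier G" "a' \<in> carrier G" "b' \<in> carrier G"
    and "H #> a' = H #> a" "H #> b' = H #> b"
  shows "H #> (a' \<otimes> b') = H #> (a \<otimes> b)"
  using assms H.rcos_sum by metis

text \<open>By \<open>ract_eq\<close> the right action is built from the left action, inverses and
  products, all of which respect cosets.\<close>

lemma coset_ract_cong:
  assumes "a \<in> carrier G" "b \<in> carrier G" "a' \<in> H #> a" "b' \<in> H #> b"
  shows "H #> ract \<sigma> a' b' = H #> ract \<sigma> a b"
proof -
  have ab': "a' \<in> carrier G" "b' \<in> carrier G"
    using assms H.subset r_coset_subset_G by blast+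
  have eq: "H #> a' = H #> a" "H #> b' = H #> b"
    using assms repr_independence[OF _ _ H.is_subgroup] by blast+
  have "H #> inv (lact \<sigma> a' b') = H #> inv (lact \<sigma> a b)"
    using coset_lact_cong[OF assms] assms ab' H.rcos_inv by (metis lact_closed)
  then show ?thesis
    using assms ab' eq by (simp add: ract_eq coset_mult_cong)
qed

text \<open>Both unions run over nonempty sets of representatives and have constant members, so each
  collapses to one coset.\<close>

lemma quotient_braiding_coset:
  assumes "a \<in> carrier G" "b \<in> carrier G"
  shows "quotient_braiding G \<sigma> H (H #> a, H #> b) = (H #> lact \<sigma> a b, H #> ract \<sigma> a b)"
proof -
  have "a \<in> H #> a" "b \<in> H #> b" using assms rcos_self[OF _ H.is_subgroup] by simp_all
  then have ne: "H #> a \<noteq> {}" "H #> b \<noteq> {}" by auto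
  have "(\<Union>a'\<in>H #> a. \<Union>b'\<in>H #> b. H #> lact \<sigma> a' b') = (\<Union>a'\<in>H #> a. \<Union>b'\<in>H #> b. H #> lact \<sigma> a b)"
    by (simp add: coset_lact_cong[OF assms] cong: SUP_cong)
  moreover have "(\<Union>a'\<in>H #> a. \<Union>b'\<in>H #> b. H #> ract \<sigma> a' b') = (\<Union>a'\<in>H #> a. \<Union>b'\<in>H #> b. H #> ract \<sigma> a b)"
    by (simp add: coset_ract_cong[OF assms] cong: SUP_cong)
  ultimately show ?thesis using ne by (simp add: quotient_braiding_def)
qed

lemma quotient_braided:
  "involutive_braided_group (G Mod H) (quotient_braiding G \<sigma> H) \<and>
   braided_epi G \<sigma> (G Mod H) (quotient_braiding G \<sigma> H) (\<lambda>g. H #> g)"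
proof (rule braided_image)
  show "group (G Mod H)" by (rule H.factorgroup_is_group)
  show "(\<lambda>g. H #> g) \<in> hom G (G Mod H)" by (rule H.r_coset_hom_Mod)
  show "(\<lambda>g. H #> g) ` carrier G = carrier (G Mod H)"
    unfolding FactGroup_def RCOSETS_def by auto
  fix a b assume ab: "a \<in> carrier G" "b \<in> carrier G"
  show "quotient_braiding G \<sigma> H (H #> a, H #> b) = map_prod ((#>) H) ((#>) H) (\<sigma> (a, b))"
    unfolding quotient_braiding_coset[OF ab] sigma_eq[of a b] by simp
qed

end

section \<open>Square-free solutions\<close>

lemma BijGroup_mult_apply:
  "\<lbrakk>f \<in> carrier (BijGroup S); g \<in> carrier (BijGroup S); x \<in> S\<rbrakk> \<Longrightarrow>
    (f \<otimes>\<^bsub>BijGroup S\<^esub> g) x = f (g x)"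
  by (simp add: BijGroup_def compose_def)

lemma BijGroup_one_apply: "x \<in> S \<Longrightarrow> \<one>\<^bsub>BijGroup S\<^esub> x = x"
  by (simp add: BijGroup_def)

lemma BijGroup_closed: "\<lbrakk>f \<in> carrier (BijGroup S); x \<in> S\<rbrakk> \<Longrightarrow> f x \<in> S"
  using Bij_imp_funcset[of f S] by (auto simp: BijGroup_def)

lemma BijGroup_eqI:
  assumes "f \<in> carrier (BijGroup S)" "g \<in> carrier (BijGroup S)" "\<And>x. x \<in> S \<Longrightarrow> f x = g x"
  shows "f = g"
  using assms Bij_imp_extensional by (intro extensionalityI[of f S g]) (auto simp: BijGroup_def)

lemma finite_BijGroup: "finite S \<Longrightarrow> finite (carrier (BijGroup S))"
  by (rule finite_subset[OF _ finite_PiE[of S "\<lambda>_. S"]])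
    (auto simp: BijGroup_def Bij_def PiE_def bij_betw_def)

locale square_free_solution =
  fixes X :: "'a set" and r :: "'a \<times> 'a \<Rightarrow> 'a \<times> 'a"
  assumes solution: "solution X r" and square_free: "square_free X r"
begin

sublocale quadratic_set X r
proof
  fix x y assume "x \<in> X" "y \<in> X"
  then show "r (x, y) \<in> X \<times> X"
    using solution bij_betwE unfolding solution_def by blast
qed

lemma lact_X [simp]: "\<lbrakk>x \<in> X; y \<in> X\<rbrakk> \<Longrightarrow> lact r x y \<in> X"
  using r_closed[of x y] by (auto simp: lact_def mem_Times_iff)

lemma lact_bij: "x \<in> X \<Longrightarrow> bij_betw (lact r x) X X"
  using solution by (simp add: solution_def nondegenerate_def)

lemma lact_self [simp]: "x \<in> X \<Longrightarrow> lact r x x = x"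
  using square_free by (simp add: square_free_def lact_def)

text \<open>Square-freeness makes \<open>\<L>\<^sub>x\<close> fix \<open>x\<close>, and injectivity
  excludes any other preimage of \<open>x\<close>.\<close>

lemma lact_eq_self_iff: "\<lbrakk>x \<in> X; y \<in> X\<rbrakk> \<Longrightarrow> lact r x y = x \<longleftrightarrow> y = x"
  using inj_onD[OF bij_betw_imp_inj_on[OF lact_bij], of x y x] by auto

lemma lact_involutive: "\<lbrakk>x \<in> X; y \<in> X; r (x, y) = (z, t)\<rbrakk> \<Longrightarrow> lact r z t = x"
proof -
  assume "x \<in> X" "y \<in> X" "r (x, y) = (z, t)"
  moreover have "\<forall>a\<in>X \<times> X. r (r a) = a"
    using solution by (simp add: solution_def involutive_on_def)
  ultimately have "r (z, t) = (x, y)" by (metis SigmaI)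
  then show ?thesis by (simp add: lact_def)
qed

text \<open>This is the first component of the Yang-Baxter equation; it says that \<L> respects the
  defining relations.\<close>

lemma lact_lact:
  assumes "x \<in> X" "y \<in> X" "w \<in> X" "r (x, y) = (z, t)"
  shows "lact r x (lact r y w) = lact r z (lact r t w)"
proof -
  have "\<forall>a\<in>X \<times> X \<times> X. r12 r (r23 r (r12 r a)) = r23 r (r12 r (r23 r a))"
    using solution by (simp add: solution_def yang_baxter_def)
  then have "r12 r (r23 r (r12 r (x, y, w))) = r23 r (r12 r (r23 r (x, y, w)))"
    using assms by simp
  then show ?thesis
    using assms(4) by (auto simp: r12_def r23_def lact_def split: prod.splits)
qed

section \<open>The action of \<open>G\<close> on \<open>X\<close> by permutations\<close>

lemma Lperm_apply: "y \<in> X \<Longrightarrow> Lperm X r x y = lact r x y"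
  by (simp add: Lperm_def)

lemma Lperm_closed: "x \<in> X \<Longrightarrow> Lperm X r x \<in> carrier (BijGroup X)"
  using lact_bij[of x] by (auto simp: BijGroup_def Bij_def Lperm_def bij_betw_restrict_eq)

sublocale P: structure_map X r "BijGroup X" "Lperm X r"
proof (intro structure_map.intro structure_map_axioms.intro group_BijGroup quadratic_set_axioms)
  fix x y z t assume xy: "x \<in> X" "y \<in> X" "r (x, y) = (z, t)"
  then have zt: "z \<in> X" "t \<in> X" using r_closed[of x y] by auto
  show "Lperm X r x \<otimes>\<^bsub>BijGroup X\<^esub> Lperm X r y = Lperm X r z \<otimes>\<^bsub>BijGroup X\<^esub> Lperm X r t"
  proof (rule BijGroup_eqI[of _ X])
    fix w assume "w \<in> X"
    then show "(Lperm X r x \<otimes>\<^bsub>BijGroup X\<^esub> Lperm X r y) w = (Lperm X r z \<otimes>\<^bsub>BijGroup X\<^esub> Lperm X r t) w"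
      using xy zt lact_lact[OF xy(1,2) _ xy(3)]
      by (simp add: BijGroup_mult_apply Lperm_closed Lperm_apply)
  qed (simp_all add: xy zt Lperm_closed group.is_monoid[OF group_BijGroup] monoid.m_closed)
qed (rule Lperm_closed)

lemma perm_hom_eq: "perm_hom X r = structure_lift (BijGroup X) (Lperm X r)"
  by (simp add: perm_hom_def structure_lift_def word_eval_def perm_word_def fun_eq_iff)

lemma perm_hom_hom: "perm_hom X r \<in> hom SG (BijGroup X)"
  unfolding perm_hom_eq by (rule P.structure_lift_hom)

lemma perm_hom_gen: "x \<in> X \<Longrightarrow> perm_hom X r (gen X r x) = Lperm X r x"
  unfolding perm_hom_eq by (rule P.structure_lift_gen)

lemma perm_hom_closed: "g \<in> carrier SG \<Longrightarrow> perm_hom X r g \<in> carrier (BijGroup X)"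
  by (rule hom_in_carrier[OF perm_hom_hom])

lemma perm_hom_X: "\<lbrakk>g \<in> carrier SG; x \<in> X\<rbrakk> \<Longrightarrow> perm_hom X r g x \<in> X"
  by (rule BijGroup_closed[OF perm_hom_closed])

lemma perm_hom_mult_apply:
  "\<lbrakk>g \<in> carrier SG; h \<in> carrier SG; x \<in> X\<rbrakk> \<Longrightarrow>
    perm_hom X r (g \<otimes>\<^bsub>SG\<^esub> h) x = perm_hom X r g (perm_hom X r h x)"
  by (simp add: hom_mult[OF perm_hom_hom] BijGroup_mult_apply perm_hom_closed)

lemma perm_hom_one: "perm_hom X r \<one>\<^bsub>SG\<^esub> = \<one>\<^bsub>BijGroup X\<^esub>"
  by (rule hom_one[OF perm_hom_hom SG_group group_BijGroup])

text \<open>Extending \<open>\<L>\<^sub>x\<close> by the identity off \<open>X\<close> gives a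
  permutation of the whole type, so the group can act on unrestricted functions.\<close>

definition extended_lact :: "'a \<Rightarrow> 'a \<Rightarrow> 'a" where
  "extended_lact x y = (if y \<in> X then lact r x y else y)"

lemma extended_lact_bij: "x \<in> X \<Longrightarrow> bij (extended_lact x)"
proof -
  assume x: "x \<in> X"
  have "bij_betw (extended_lact x) X X"
    using lact_bij[OF x] by (rule bij_betw_cong[THEN iffD1, rotated]) (simp add: extended_lact_def)
  moreover have "bij_betw (extended_lact x) (- X) (- X)"
    using bij_betw_id[of "- X"] by (rule bij_betw_cong[THEN iffD1, rotated]) (simp add: extended_lact_def)
  ultimately have "bij_betw (extended_lact x) (X \<union> - X) (X \<union> - X)"
    by (rule bij_betw_combine) simp
  then show ?thesis by simp
qed

lemma extended_lact_eq_self_iff: "x \<in> X \<Longrightarrow> extended_lact x y = x \<longleftrightarrow> y = x"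
  by (auto simp: extended_lact_def lact_eq_self_iff)

lemma extended_lact_lact:
  assumes "x \<in> X" "y \<in> X" "r (x, y) = (z, t)"
  shows "extended_lact x (extended_lact y w) = extended_lact z (extended_lact t w)"
  using assms r_closed[of x y] lact_lact[of x y w] by (auto simp: extended_lact_def)

text \<open>The group acts on the functions on \<open>X\<close> by affine maps whose linear part permutes the
  coordinates; the orbit map of \<open>0\<close> is the bijective 1-cocycle of Etingof, Schedler and Soloviev.\<close>

definition affine :: "'a \<Rightarrow> ('a \<Rightarrow> int) \<Rightarrow> ('a \<Rightarrow> int)" where
  "affine x v = (\<lambda>z. v (inv_into UNIV (extended_lact x) z) + (if z = x then 1 else 0))"

definition affine_inv :: "'a \<Rightarrow> ('a \<Rightarrow> int) \<Rightarrow> ('a \<Rightarrow> int)" where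
  "affine_inv x v = (\<lambda>z. v (extended_lact x z) - (if z = x then 1 else 0))"

text \<open>Evaluation at \<open>extended_lact x z\<close> removes the inverse permutation; the
  increment sits at \<open>z = x\<close> because \<open>x\<close> is the only point sent to
  \<open>x\<close>.\<close>

lemma affine_apply:
  "x \<in> X \<Longrightarrow> affine x v (extended_lact x z) = v z + (if z = x then 1 else 0)"
  using extended_lact_bij[of x]
  by (simp add: affine_def extended_lact_eq_self_iff bij_is_inj)

lemma affine_affine_inv: "x \<in> X \<Longrightarrow> affine x (affine_inv x v) = v"
proof
  fix z assume x: "x \<in> X"
  obtain w where "z = extended_lact x w" using surjD[OF bij_is_surj[OF extended_lact_bij[OF x]]] by blast
  then show "affine x (affine_inv x v) z = v z" using x by (simp add: affine_apply affine_inv_def)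
qed

lemma affine_inv_affine: "x \<in> X \<Longrightarrow> affine_inv x (affine x v) = v"
  by (simp add: affine_inv_def affine_apply fun_eq_iff)

lemma affine_bij: "x \<in> X \<Longrightarrow> bij (affine x)"
  by (rule bij_betw_byWitness[where f' = "affine_inv x"])
    (auto simp: affine_affine_inv affine_inv_affine)

lemma BijGroup_UNIV_closed: "f \<in> carrier (BijGroup UNIV) \<longleftrightarrow> bij f"
  by (simp add: BijGroup_def Bij_def)

text \<open>For \<open>r (x, y) = (z, t)\<close> the linear parts of both composites agree by
  \<open>extended_lact_lact\<close>. The translation part is \<open>e\<^sub>x + e\<^sub>z\<close> on
  both sides, since \<open>\<L>\<^sub>x\<close> sends \<open>y\<close> to \<open>z\<close> and, by
  involutivity, \<open>\<L>\<^sub>z\<close> sends \<open>t\<close> to \<open>x\<close>.\<close>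

sublocale A: structure_map X r "BijGroup (UNIV :: ('a \<Rightarrow> int) set)" affine
proof (intro structure_map.intro structure_map_axioms.intro group_BijGroup quadratic_set_axioms)
  fix x assume "x \<in> X"
  then show "affine x \<in> carrier (BijGroup UNIV)" by (simp add: BijGroup_UNIV_closed affine_bij)
next
  fix x y z t assume xy: "x \<in> X" "y \<in> X" "r (x, y) = (z, t)"
  then have zt: "z \<in> X" "t \<in> X" using r_closed[of x y] by auto
  have "affine x (affine y v) u = affine z (affine t v) u" for v u
  proof -
    \<comment> \<open>Writing \<open>u\<close> as the image of some \<open>w\<close> under both
      composite permutations allows evaluation by \<open>affine_apply\<close> alone.\<close>
    obtain u' where u': "u = extended_lact x u'"
      using surjD[OF bij_is_surj[OF extended_lact_bij[OF xy(1)]]] by blast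
    obtain w where w: "u' = extended_lact y w"
      using surjD[OF bij_is_surj[OF extended_lact_bij[OF xy(2)]]] by blast
    have y_iff: "w = y \<longleftrightarrow> u = z"
    proof -
      have "z = extended_lact x y" using xy by (simp add: extended_lact_def lact_def)
      moreover have "inj (extended_lact x)" using extended_lact_bij[OF xy(1)] by (rule bij_is_inj)
      ultimately show ?thesis
        using u' w extended_lact_eq_self_iff[OF xy(2), of w] by (metis injD)
    qed
    have t_iff: "w = t \<longleftrightarrow> u = x"
    proof -
      have "x = extended_lact z t"
        using lact_involutive[OF xy] zt by (simp add: extended_lact_def)
      moreover have "inj (extended_lact z)" using extended_lact_bij[OF zt(1)] by (rule bij_is_inj)
      moreover have "u = extended_lact z (extended_lact t w)"
        using u' w extended_lact_lact[OF xy] by simp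
      ultimately show ?thesis
        using extended_lact_eq_self_iff[OF zt(2), of w] by (metis injD)
    qed
    have "affine x (affine y v) u = v w + (if w = y then 1 else 0) + (if u = x then 1 else 0)"
      using u' w xy by (simp add: affine_apply extended_lact_eq_self_iff)
    moreover have "affine z (affine t v) (extended_lact z (extended_lact t w)) =
        v w + (if w = t then 1 else 0) + (if extended_lact t w = z then 1 else 0)"
      using zt by (simp add: affine_apply)
    moreover have "extended_lact t w = z \<longleftrightarrow> u = z"
      using u' w extended_lact_lact[OF xy] extended_lact_eq_self_iff[OF zt(1)] by simp
    ultimately show ?thesis
      using u' w extended_lact_lact[OF xy] y_iff t_iff by simp
  qed
  then have "affine x \<circ> affine y = affine z \<circ> affine t" by (simp add: fun_eq_iff)
  then show "affine x \<otimes>\<^bsub>BijGroup UNIV\<^esub> affine y = affine z \<otimes>\<^bsub>BijGroup UNIV\<^esub> affine t"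
    using xy zt affine_bij by (simp add: BijGroup_def Bij_def compose_def comp_def)
qed

section \<open>The affine action of \<open>G\<close> and the orbit of \<open>0\<close>\<close>

definition shift :: "('a \<times> bool) list set \<Rightarrow> ('a \<Rightarrow> int) \<Rightarrow> ('a \<Rightarrow> int)" where
  "shift = structure_lift (BijGroup UNIV) affine"

lemma shift_hom: "shift \<in> hom SG (BijGroup UNIV)"
  unfolding shift_def by (rule A.structure_lift_hom)

lemma shift_gen: "x \<in> X \<Longrightarrow> shift (gen X r x) v = affine x v"
  by (simp add: shift_def A.structure_lift_gen)

lemma shift_mult:
  "\<lbrakk>g \<in> carrier SG; h \<in> carrier SG\<rbrakk> \<Longrightarrow> shift (g \<otimes>\<^bsub>SG\<^esub> h) v = shift g (shift h v)"
  by (simp add: hom_mult[OF shift_hom] BijGroup_mult_apply hom_in_carrier[OF shift_hom])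

lemma shift_one [simp]: "shift \<one>\<^bsub>SG\<^esub> v = v"
  by (simp add: hom_one[OF shift_hom SG_group group_BijGroup] BijGroup_one_apply)

lemma shift_inv_gen: "x \<in> X \<Longrightarrow> shift (inv\<^bsub>SG\<^esub> gen X r x) v = affine_inv x v"
  using shift_mult[of "inv\<^bsub>SG\<^esub> gen X r x" "gen X r x" "affine_inv x v"]
  by (simp add: gen_closed shift_gen affine_affine_inv)

text \<open>The affine maps permute coordinates and add constants, so they descend to functions
  modulo \<open>m\<close>.\<close>

lemma shift_cong:
  assumes "g \<in> carrier SG" "\<And>z. v z mod m = w z mod m"
  shows "shift g v z mod m = shift g w z mod m"
  using assms(1)
proof (induction arbitrary: z rule: SG_induct)
  case one
  then show ?case using assms(2) by simp
next
  case (gen x g)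
  show ?case
    using gen(1,2) mod_add_cong[OF gen.IH HOL.refl]
    by (simp add: shift_mult gen_closed shift_gen affine_def)
next
  case (inv_gen x g)
  show ?case
    using inv_gen(1,2) mod_diff_cong[OF inv_gen.IH HOL.refl]
    by (simp add: shift_mult gen_closed shift_inv_gen affine_inv_def)
qed

text \<open>The generator of \<open>x\<close> moves \<open>0\<close> to \<open>e\<^sub>x\<close>,
  which determines \<open>x\<close>.\<close>

lemma gen_inj: "inj_on (gen X r) X"
proof (rule inj_onI)
  fix x y assume xy: "x \<in> X" "y \<in> X" "gen X r x = gen X r y"
  then have "affine x (\<lambda>_. 0) x = affine y (\<lambda>_. 0) x" by (metis shift_gen)
  then show "x = y" by (simp add: affine_def split: if_splits)
qed

lemma Lperm_pow: "\<lbrakk>x \<in> X; y \<in> X\<rbrakk> \<Longrightarrow>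
    (Lperm X r x [^]\<^bsub>BijGroup X\<^esub> k) y = (extended_lact x ^^ k) y"
proof (induction k)
  case 0
  then show ?case by (simp add: BijGroup_one_apply)
next
  case (Suc k)
  have "(extended_lact x ^^ k) y \<in> X"
    using Suc(2,3) by (induction k) (auto simp: extended_lact_def)
  moreover have "extended_lact x ((extended_lact x ^^ k) y) = lact r x ((extended_lact x ^^ k) y)"
    using calculation by (simp add: extended_lact_def)
  ultimately show ?case
    using Suc unfolding P.H.nat_pow_Suc2[OF Lperm_closed[OF Suc(2)]]
    by (simp add: BijGroup_mult_apply Lperm_closed Lperm_apply)
qed

text \<open>All iterates of \<open>\<L>\<^sub>x\<close> fix \<open>x\<close>, so the
  \<open>k\<close> increments accumulate at the single coordinate \<open>x\<close>.\<close>

lemma shift_gen_pow: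
  assumes x: "x \<in> X"
  shows "shift (gen X r x [^]\<^bsub>SG\<^esub> k) v ((extended_lact x ^^ k) z) = v z + (if z = x then int k else 0)"
proof (induction k)
  case (Suc k)
  have "(extended_lact x ^^ k) z = x \<longleftrightarrow> z = x"
    by (induction k) (simp_all add: extended_lact_eq_self_iff x)
  then show ?case
    using Suc x unfolding SG.nat_pow_Suc2[OF gen_closed[OF x]]
    by (simp add: shift_mult gen_closed shift_gen affine_apply)
qed simp

text \<open>Induction on the coordinate sum over \<open>X\<close>: if \<open>v x > 0\<close>, then
  \<open>affine_inv x v\<close> is again nonnegative and zero off \<open>X\<close>, with sum one
  smaller. Nonnegative functions suffice to represent all residues modulo \<open>p\<close>.\<close>

lemma cocycle_surj:
  assumes "finite X" "\<And>z. v z \<ge> 0" "\<And>z. z \<notin> X \<Longrightarrow> v z = 0"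
  shows "\<exists>g\<in>carrier SG. shift g (\<lambda>_. 0) = v"
  using assms(2,3)
proof (induction "nat (\<Sum>z\<in>X. v z)" arbitrary: v)
  case 0
  then have "v z = 0" if "z \<in> X" for z
    using that sum_nonneg_0[OF assms(1), of v z] sum_nonneg[of X v] by auto
  then have "v = (\<lambda>_. 0)" using 0 by (auto simp: fun_eq_iff)
  then show ?case by (intro bexI[of _ "\<one>\<^bsub>SG\<^esub>"]) auto
next
  case (Suc d)
  have "\<exists>x\<in>X. v x > 0"
  proof (rule ccontr)
    assume "\<not> (\<exists>x\<in>X. v x > 0)"
    then have "(\<Sum>z\<in>X. v z) \<le> 0" by (intro sum_nonpos) force
    then show False using Suc by simp
  qed
  then obtain x where x: "x \<in> X" "v x > 0" by blast
  let ?u = "affine_inv x v"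
  \<comment> \<open>The permutation \<open>\<L>\<^sub>x\<close> preserves the sum; only the
    subtracted \<open>e\<^sub>x\<close> changes it.\<close>
  have "(\<Sum>z\<in>X. ?u z) = (\<Sum>z\<in>X. v (lact r x z)) - 1"
    using x assms(1) by (simp add: affine_inv_def sum_subtractf extended_lact_def)
  also have "\<dots> = (\<Sum>z\<in>X. v z) - 1"
    using sum.reindex_bij_betw[OF lact_bij[OF x(1)], of v] by simp
  finally have "d = nat (\<Sum>z\<in>X. ?u z)" using Suc(2) by simp
  moreover have "?u z \<ge> 0" for z
    using Suc(3)[of "extended_lact x z"] x by (auto simp: affine_inv_def extended_lact_def)
  moreover have "?u z = 0" if "z \<notin> X" for z
    using that Suc(4)[of z] x by (auto simp: affine_inv_def extended_lact_def)
  ultimately obtain g where g: "g \<in> carrier SG" "shift g (\<lambda>_. 0) = ?u"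
    using Suc(1)[of ?u] by blast
  have "shift (gen X r x \<otimes>\<^bsub>SG\<^esub> g) (\<lambda>_. 0) = v"
    using g x by (simp add: shift_mult gen_closed shift_gen affine_affine_inv)
  then show ?case using g x gen_closed by (intro bexI[of _ "gen X r x \<otimes>\<^bsub>SG\<^esub> g"]) auto
qed

end

section \<open>The ideal generated by the p-th powers\<close>

locale finite_square_free_solution = square_free_solution +
  assumes finite_X: "finite X"
begin

abbreviation "p \<equiv> cyclic_degree X r"
abbreviation "Fp \<equiv> power_subgroup X r p"

text \<open>Orders in the finite symmetric group are positive, hence so is the lcm of finitely many
  of them.\<close>

lemma p_pos: "p > 0"
proof -
  have "0 \<notin> (\<lambda>x. group.ord (BijGroup X) (Lperm X r x)) ` X"
    using P.H.ord_ge_1[OF finite_BijGroup[OF finite_X] Lperm_closed] by force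
  then show ?thesis
    unfolding cyclic_degree_def using finite_X by (metis Lcm_0_iff_nat finite_imageI gr0I)
qed

lemma Lperm_pow_p: "x \<in> X \<Longrightarrow> Lperm X r x [^]\<^bsub>BijGroup X\<^esub> p = \<one>\<^bsub>BijGroup X\<^esub>"
  by (simp add: P.H.pow_eq_id Lperm_closed cyclic_degree_def)

lemma extended_lact_pow_p: "x \<in> X \<Longrightarrow> (extended_lact x ^^ p) y = y"
proof (cases "y \<in> X")
  case True
  then show "x \<in> X \<Longrightarrow> ?thesis"
    using Lperm_pow[of x y p] by (simp add: Lperm_pow_p BijGroup_one_apply)
next
  case False
  have "(extended_lact x ^^ k) y = y" for k
    using False by (induction k) (simp_all add: extended_lact_def)
  then show ?thesis .
qed

lemma shift_gen_pow_p:
  "x \<in> X \<Longrightarrow> shift (gen X r x [^]\<^bsub>SG\<^esub> p) v z = v z + (if z = x then int p else 0)"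
  using shift_gen_pow[of x p v z] by (simp add: extended_lact_pow_p)

lemma Fp_closed: "W \<in> Fp \<Longrightarrow> W \<in> carrier SG"
  unfolding power_subgroup_def
  by (rule SG.generate_in_carrier[rotated]) (auto simp: gen_closed)

lemma gen_pow_p_Fp: "x \<in> X \<Longrightarrow> gen X r x [^]\<^bsub>SG\<^esub> p \<in> Fp"
  by (auto simp: power_subgroup_def intro: generate.incl)

text \<open>Each generator of \<open>Fp\<close> translates by a multiple of \<open>p\<close>, which
  is invisible modulo \<open>p\<close>.\<close>

lemma shift_Fp: "W \<in> Fp \<Longrightarrow> shift W v z mod int p = v z mod int p"
  unfolding power_subgroup_def
proof (induction arbitrary: v rule: generate.induct)
  case (incl h)
  then show ?case by (auto simp: shift_gen_pow_p)
next
  case (inv h)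
  then obtain x where x: "x \<in> X" and h: "h = gen X r x [^]\<^bsub>SG\<^esub> p" by blast
  then have "h \<in> carrier SG" by (simp add: gen_closed)
  \<comment> \<open>The action of the inverse is found by solving the translation formula for
    \<open>h\<close> at \<open>shift (inv h) v\<close>.\<close>
  then have "shift h (shift (inv\<^bsub>SG\<^esub> h) v) = v"
    using shift_mult[of h "inv\<^bsub>SG\<^esub> h" v] by simp
  then have "v z = shift (inv\<^bsub>SG\<^esub> h) v z + (if z = x then int p else 0)"
    using shift_gen_pow_p[OF x] h by metis
  then show ?case by simp
next
  case (eng h1 h2)
  then have "h1 \<in> carrier SG" "h2 \<in> carrier SG"
    using Fp_closed by (simp_all add: power_subgroup_def)
  then show ?case using eng by (simp add: shift_mult)
qed simp

text \<open>The 1-cocycle reduced modulo \<open>p\<close>. Restriction to \<open>X\<close> places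
  its values in an extensional function space with \<open>p ^ card X\<close> elements.\<close>

definition residue :: "('a \<times> bool) list set \<Rightarrow> 'a \<Rightarrow> int" where
  "residue g = (\<lambda>z\<in>X. shift g (\<lambda>_. 0) z mod int p)"

text \<open>\<open>W\<close> moves \<open>0\<close> to a function congruent to \<open>0\<close>, and
  \<open>g\<close> preserves congruences.\<close>

lemma residue_mult_Fp:
  assumes "g \<in> carrier SG" "W \<in> Fp"
  shows "residue (g \<otimes>\<^bsub>SG\<^esub> W) = residue g"
  using shift_cong[OF assms(1) shift_Fp[OF assms(2)]] assms Fp_closed
  by (simp add: residue_def shift_mult)

lemma residue_surj: "residue ` carrier SG = (X \<rightarrow>\<^sub>E {0..<int p})"
proof
  show "residue ` carrier SG \<subseteq> (X \<rightarrow>\<^sub>E {0..<int p})"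
    using p_pos by (auto simp: residue_def)
  show "(X \<rightarrow>\<^sub>E {0..<int p}) \<subseteq> residue ` carrier SG"
  proof
    fix v :: "'a \<Rightarrow> int" assume v: "v \<in> X \<rightarrow>\<^sub>E {0..<int p}"
    \<comment> \<open>Outside \<open>X\<close> the extensional \<open>v\<close> is
      \<open>undefined\<close>, while \<open>cocycle_surj\<close> asks for \<open>0\<close>
      there.\<close>
    let ?v = "\<lambda>z. if z \<in> X then v z else 0"
    have "?v z \<ge> 0" for z using v by (auto simp: PiE_iff)
    then obtain g where "g \<in> carrier SG" "shift g (\<lambda>_. 0) = ?v"
      using cocycle_surj[OF finite_X, of ?v] by auto
    moreover have "v = (\<lambda>z\<in>X. ?v z mod int p)"
      using v by (auto simp: PiE_iff extensional_def fun_eq_iff)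
    ultimately show "v \<in> residue ` carrier SG" by (intro image_eqI[of _ _ g]) (simp_all add: residue_def)
  qed
qed

lemma residue_gen: "\<lbrakk>x \<in> X; z \<in> X\<rbrakk> \<Longrightarrow> residue (gen X r x) z = (if z = x then 1 else 0) mod int p"
  by (simp add: residue_def shift_gen affine_def)

end

section \<open>The braiding on generators, the socle and the ideal \<open>Fp\<close>\<close>

locale braided_solution = finite_square_free_solution +
  fixes \<sigma>
  assumes braiding: "associated_braiding X r \<sigma>"
begin

sublocale B: involutive_braided_group SG \<sigma>
  using braiding by (simp add: associated_braiding_def)

abbreviation "\<Gamma> \<equiv> socle SG \<sigma>"

lemma sigma_gen:
  "\<lbrakk>x \<in> X; y \<in> X\<rbrakk> \<Longrightarrow> \<sigma> (gen X r x, gen X r y) = map_prod (gen X r) (gen X r) (r (x, y))"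
  using braiding by (simp add: associated_braiding_def)

lemma lact_gen_gen: "\<lbrakk>x \<in> X; y \<in> X\<rbrakk> \<Longrightarrow> lact \<sigma> (gen X r x) (gen X r y) = gen X r (lact r x y)"
  by (simp add: lact_def sigma_gen)

text \<open>Both sides are actions of \<open>G\<close> agreeing on generators. In the inverse case
  the point \<open>?w\<close> is recovered by applying \<open>y\<close> to it, which gives the image
  of \<open>x\<close> under \<open>g\<close>.\<close>

lemma lact_gen:
  assumes "g \<in> carrier SG" "x \<in> X"
  shows "lact \<sigma> g (gen X r x) = gen X r (perm_hom X r g x)"
  using assms(1)
proof (induction rule: SG_induct)
  case one
  then show ?case using assms by (simp add: B.one_lact gen_closed perm_hom_one BijGroup_one_apply)
next
  case (gen y g)
  then show ?case
    using assms by (simp add: B.mult_lact gen_closed perm_hom_mult_apply perm_hom_gen Lperm_apply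
      perm_hom_X lact_gen_gen)
next
  case (inv_gen y g)
  let ?w = "perm_hom X r (inv\<^bsub>SG\<^esub> gen X r y \<otimes>\<^bsub>SG\<^esub> g) x"
  have c: "gen X r y \<in> carrier SG" "inv\<^bsub>SG\<^esub> gen X r y \<otimes>\<^bsub>SG\<^esub> g \<in> carrier SG"
    using inv_gen by (simp_all add: gen_closed)
  have w: "?w \<in> X" using c assms by (simp add: perm_hom_X)
  have "gen X r y \<otimes>\<^bsub>SG\<^esub> (inv\<^bsub>SG\<^esub> gen X r y \<otimes>\<^bsub>SG\<^esub> g) = g"
    using inv_gen(2) c(1) by (simp add: SG.m_assoc[symmetric])
  then have "perm_hom X r g x = perm_hom X r (gen X r y) ?w"
    using perm_hom_mult_apply[OF c assms(2)] by simp
  also have "\<dots> = lact r y ?w" using inv_gen(1) w by (simp add: perm_hom_gen Lperm_apply)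
  finally have "lact \<sigma> g (gen X r x) = lact \<sigma> (gen X r y) (gen X r ?w)"
    using inv_gen w by (simp add: lact_gen_gen)
  then show ?case
    using inv_gen(1,2) c(1) w assms(2) by (simp add: B.mult_lact gen_closed)
qed

text \<open>The induction is on \<open>u\<close> with \<open>g\<close> varying. If \<open>g\<close>
  fixes a generator, then \<open>ract_eq\<close> makes the right action of that generator on
  \<open>g\<close> a conjugation, which stays in the normal kernel, so the hypothesis applies to the
  rest of \<open>u\<close>.\<close>

lemma kernel_subset_socle:
  assumes u: "u \<in> carrier SG"
    and g: "g \<in> kernel SG (BijGroup X) (perm_hom X r)"
  shows "lact \<sigma> g u = u"
  using u g
proof (induction arbitrary: g rule: SG_induct)
  case one
  then show ?case by (simp add: B.lact_one kernel_def)
next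
  case (gen x u)
  let ?K = "kernel SG (BijGroup X) (perm_hom X r)"
  interpret K: normal ?K SG
    by (rule group_hom.normal_kernel)
      (intro group_hom.intro group_hom_axioms.intro SG_group group_BijGroup perm_hom_hom)
  have c: "g \<in> carrier SG" "gen X r x \<in> carrier SG"
    using gen.hyps gen.prems by (simp_all add: gen_closed)
  have "perm_hom X r g = \<one>\<^bsub>BijGroup X\<^esub>" using gen.prems unfolding kernel_def by blast
  then have fix_gen: "lact \<sigma> g (gen X r x) = gen X r x"
    using gen.hyps c by (simp add: lact_gen BijGroup_one_apply)
  then have "ract \<sigma> g (gen X r x) \<in> ?K"
    using c K.inv_op_closed1[OF c(2) gen.prems] by (simp add: B.ract_eq)
  then have "lact \<sigma> (ract \<sigma> g (gen X r x)) u = u" by (rule gen.IH)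
  then show ?case using gen.hyps c fix_gen by (simp add: B.lact_mult)
next
  case (inv_gen x u)
  let ?K = "kernel SG (BijGroup X) (perm_hom X r)" and ?x = "gen X r x"
  interpret K: normal ?K SG
    by (rule group_hom.normal_kernel)
      (intro group_hom.intro group_hom_axioms.intro SG_group group_BijGroup perm_hom_hom)
  have c: "g \<in> carrier SG" "?x \<in> carrier SG"
    using inv_gen.hyps inv_gen.prems by (simp_all add: gen_closed)
  \<comment> \<open>The conjugate is chosen so that the right action of \<open>?x\<close> turns
    \<open>g'\<close> back into \<open>g\<close>.\<close>
  define g' where "g' = ?x \<otimes>\<^bsub>SG\<^esub> g \<otimes>\<^bsub>SG\<^esub> inv\<^bsub>SG\<^esub> ?x"
  have g': "g' \<in> ?K" "g' \<in> carrier SG"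
    unfolding g'_def using K.inv_op_closed2[OF c(2) inv_gen.prems] c by auto
  have "perm_hom X r g' = \<one>\<^bsub>BijGroup X\<^esub>" using g'(1) unfolding kernel_def by blast
  then have fix_gen: "lact \<sigma> g' ?x = ?x"
    using inv_gen.hyps g' by (simp add: lact_gen BijGroup_one_apply)
  have "ract \<sigma> g' ?x = g"
    unfolding B.ract_eq[OF g'(2) c(2)] fix_gen
    using c by (simp add: g'_def SG.m_assoc) (simp add: SG.m_assoc[symmetric])
  \<comment> \<open>This expands the action of \<open>g'\<close> on \<open>?x\<close> times its
    inverse, a product equal to the identity.\<close>
  then have "\<one>\<^bsub>SG\<^esub> = ?x \<otimes>\<^bsub>SG\<^esub> lact \<sigma> g (inv\<^bsub>SG\<^esub> ?x)"
    using B.lact_mult[of g' ?x "inv\<^bsub>SG\<^esub> ?x"] c g' fix_gen B.lact_one[of g'] by simp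
  then have fix_inv: "lact \<sigma> g (inv\<^bsub>SG\<^esub> ?x) = inv\<^bsub>SG\<^esub> ?x"
    using c by (metis B.lact_closed SG.inv_closed SG.inv_equality SG.inv_inv)
  then have "ract \<sigma> g (inv\<^bsub>SG\<^esub> ?x) \<in> ?K"
    using c g'(1) by (simp add: B.ract_eq g'_def)
  then have "lact \<sigma> (ract \<sigma> g (inv\<^bsub>SG\<^esub> ?x)) u = u" by (rule inv_gen.IH)
  then show ?case using inv_gen.hyps c fix_inv by (simp add: B.lact_mult)
qed

text \<open>For the remaining inclusion, a socle element fixes all generators in \<open>G\<close>,
  and injectivity of \<open>gen X r\<close> turns this into a statement about points of
  \<open>X\<close>.\<close>

lemma socle_eq_kernel: "\<Gamma> = kernel SG (BijGroup X) (perm_hom X r)"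
proof (intro equalityI subsetI)
  fix g assume "g \<in> kernel SG (BijGroup X) (perm_hom X r)"
  then show "g \<in> \<Gamma>" using kernel_subset_socle by (simp add: socle_def kernel_def)
next
  fix g assume g: "g \<in> \<Gamma>"
  then have c: "g \<in> carrier SG" using B.socle_subset by blast
  have "perm_hom X r g = \<one>\<^bsub>BijGroup X\<^esub>"
  proof (rule BijGroup_eqI[of _ X])
    fix x assume x: "x \<in> X"
    then have "gen X r (perm_hom X r g x) = gen X r x"
      using lact_gen[OF c x] B.socle_lact[OF g gen_closed[OF x]] by simp
    then show "perm_hom X r g x = \<one>\<^bsub>BijGroup X\<^esub> x"
      using inj_onD[OF gen_inj] x c by (simp add: perm_hom_X BijGroup_one_apply)
  qed (use c in \<open>simp_all add: perm_hom_closed\<close>)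
  then show "g \<in> kernel SG (BijGroup X) (perm_hom X r)" using c by (simp add: kernel_def)
qed

lemma gen_pow_p_socle: "x \<in> X \<Longrightarrow> gen X r x [^]\<^bsub>SG\<^esub> p \<in> \<Gamma>"
proof -
  assume x: "x \<in> X"
  interpret L: group_hom SG "BijGroup X" "perm_hom X r"
    by (intro group_hom.intro group_hom_axioms.intro SG_group group_BijGroup perm_hom_hom)
  have "perm_hom X r (gen X r x [^]\<^bsub>SG\<^esub> p) = \<one>\<^bsub>BijGroup X\<^esub>"
    using x by (simp add: L.hom_nat_pow gen_closed perm_hom_gen Lperm_pow_p)
  then show ?thesis using x by (simp add: socle_eq_kernel kernel_def gen_closed)
qed

lemma Fp_subset_socle: "Fp \<subseteq> \<Gamma>"
proof -
  have "subgroup \<Gamma> SG" using B.socle_normal by (simp add: normal_def)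
  then show ?thesis
    unfolding power_subgroup_def by (rule SG.generate_subgroup_incl[rotated])
      (auto intro: gen_pow_p_socle)
qed

text \<open>Let \<open>g\<close> send \<open>x\<close> to \<open>y\<close>. Both sides of
  \<open>g x = y (ract g x)\<close> act on \<open>x\<close>; as \<open>x\<close> and
  \<open>y\<close> fix themselves by square-freeness, cancelling the action of \<open>y\<close>
  gives the claim.\<close>

lemma lact_ract_gen:
  assumes "g \<in> carrier SG" "x \<in> X"
  shows "lact \<sigma> (ract \<sigma> g (gen X r x)) (gen X r x) = lact \<sigma> g (gen X r x)"
proof -
  let ?x = "gen X r x" and ?y = "gen X r (perm_hom X r g x)"
  have fixed: "lact \<sigma> (gen X r z) (gen X r z) = gen X r z" if "z \<in> X" for z
    using that by (simp add: lact_gen_gen)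
  have c: "?x \<in> carrier SG" "?y \<in> carrier SG" using assms by (simp_all add: gen_closed perm_hom_X)
  have y: "lact \<sigma> g ?x = ?y" using assms by (rule lact_gen)
  have "lact \<sigma> ?y (lact \<sigma> (ract \<sigma> g ?x) ?x) = lact \<sigma> (?y \<otimes>\<^bsub>SG\<^esub> ract \<sigma> g ?x) ?x"
    using assms c by (simp add: B.mult_lact)
  also have "\<dots> = lact \<sigma> (g \<otimes>\<^bsub>SG\<^esub> ?x) ?x"
    using B.braided_comm[OF assms(1) c(1)] y by simp
  also have "\<dots> = ?y" using assms c y by (simp add: B.mult_lact fixed)
  also have "\<dots> = lact \<sigma> ?y ?y" using assms by (simp add: fixed perm_hom_X)
  finally show ?thesis
    using B.lact_inj[of ?y "lact \<sigma> (ract \<sigma> g ?x) ?x" ?y] assms c y by simp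
qed

text \<open>Splitting off one factor \<open>x\<close> replaces \<open>g\<close> by
  \<open>ract \<sigma> g x\<close>, which sends \<open>x\<close> to the same generator by
  \<open>lact_ract_gen\<close>; hence \<open>g\<close> must vary in the induction.\<close>

lemma lact_gen_pow:
  "\<lbrakk>g \<in> carrier SG; x \<in> X\<rbrakk> \<Longrightarrow>
    lact \<sigma> g (gen X r x [^]\<^bsub>SG\<^esub> k) = gen X r (perm_hom X r g x) [^]\<^bsub>SG\<^esub> (k::nat)"
proof (induction k arbitrary: g)
  case 0
  then show ?case by (simp add: B.lact_one)
next
  case (Suc k)
  let ?x = "gen X r x" and ?y = "gen X r (perm_hom X r g x)"
  have c: "?x \<in> carrier SG" "?y \<in> carrier SG" using Suc by (simp_all add: gen_closed perm_hom_X)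
  have "ract \<sigma> g ?x \<in> carrier SG" using Suc c by simp
  moreover from this have "gen X r (perm_hom X r (ract \<sigma> g ?x) x) = ?y"
    using lact_ract_gen[OF Suc(2,3)] lact_gen Suc(2,3) by simp
  ultimately have "lact \<sigma> (ract \<sigma> g ?x) (?x [^]\<^bsub>SG\<^esub> k) = ?y [^]\<^bsub>SG\<^esub> k"
    using Suc by metis
  then show ?case
    unfolding SG.nat_pow_Suc2[OF c(1)] SG.nat_pow_Suc2[OF c(2)]
    using Suc(2,3) c by (simp add: B.lact_mult lact_gen)
qed

text \<open>The \<open>p\<close>-th powers lie in the socle, where conjugation is the left action,
  and the left action sends each to the \<open>p\<close>-th power of a generator.\<close>

lemma Fp_normal: "Fp \<lhd> SG"
  unfolding power_subgroup_def
proof (rule SG.normal_generateI)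
  show "(\<lambda>x. gen X r x [^]\<^bsub>SG\<^esub> p) ` X \<subseteq> carrier SG" by (auto simp: gen_closed)
next
  fix h g assume "h \<in> (\<lambda>x. gen X r x [^]\<^bsub>SG\<^esub> p) ` X" and g: "g \<in> carrier SG"
  then obtain x where x: "x \<in> X" "h = gen X r x [^]\<^bsub>SG\<^esub> p" by blast
  have "g \<otimes>\<^bsub>SG\<^esub> h \<otimes>\<^bsub>SG\<^esub> inv\<^bsub>SG\<^esub> g = gen X r (perm_hom X r g x) [^]\<^bsub>SG\<^esub> p"
    using B.lact_socle[OF gen_pow_p_socle[OF x(1)] g] lact_gen_pow[OF g x(1), of p] x by simp
  then show "g \<otimes>\<^bsub>SG\<^esub> h \<otimes>\<^bsub>SG\<^esub> inv\<^bsub>SG\<^esub> g \<in> (\<lambda>x. gen X r x [^]\<^bsub>SG\<^esub> p) ` X"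
    using perm_hom_X[OF g x(1)] by blast
qed

text \<open>Inside the socle the left action is conjugation, so normality gives stability.\<close>

lemma lact_Fp: "\<lbrakk>g \<in> carrier SG; h \<in> Fp\<rbrakk> \<Longrightarrow> lact \<sigma> g h \<in> Fp"
  using B.lact_socle[of h g] Fp_subset_socle normal.inv_op_closed2[OF Fp_normal] by auto

lemma Fp_ideal: "braided_ideal SG \<sigma> Fp"
  by (simp add: braided_ideal_def Fp_normal lact_Fp)

lemma Fp_ideal_socle: "braided_ideal (SG\<lparr>carrier := \<Gamma>\<rparr>) \<sigma> Fp"
proof -
  have "subgroup \<Gamma> SG" using B.socle_normal by (simp add: normal_def)
  then have "Fp \<lhd> SG\<lparr>carrier := \<Gamma>\<rparr>"
    using SG.normal_restrict_supergroup Fp_normal Fp_subset_socle by blast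
  then show ?thesis using lact_Fp B.socle_subset by (auto simp: braided_ideal_def)
qed

sublocale Q: braided_quotient SG \<sigma> Fp
  by unfold_locales (rule Fp_ideal)

sublocale QS: braided_quotient SG \<sigma> \<Gamma>
  by unfold_locales (rule B.socle_ideal)

end

section \<open>The permutation group\<close>

lemma (in group_hom) order_image_dvd:
  assumes "h ` carrier G = carrier H"
  shows "order H dvd order G"
proof -
  have "(\<lambda>X. the_elem (h ` X)) \<in> iso (G Mod kernel G H h) H"
    by (rule FactGroup_iso_set[OF assms])
  then have "card (carrier (G Mod kernel G H h)) = order H"
    by (auto simp: iso_def order_def intro: bij_betw_same_card)
  then show ?thesis
    using G.lagrange[OF subgroup_kernel] by (metis FactGroup_def dvd_triv_left partial_object.simps(1))
qed

lemma p_group_if_order_dvd: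
  fixes p :: nat
  assumes G: "group G" and "order G dvd p ^ n" and p: "Factorial_Ring.prime p"
  shows "p_group p G"
  unfolding p_group_def
proof (intro conjI ballI)
  fix g assume "g \<in> carrier G"
  then have "group.ord G g dvd p ^ n"
    using assms(2) group.ord_dvd_group_order[OF G] by (blast intro: dvd_trans)
  then show "\<exists>k. group.ord G g = p ^ k" using p by (auto simp: divides_primepow_nat)
qed (rule G)

context braided_solution
begin

abbreviation "PG \<equiv> perm_group X r"
abbreviation "PB \<equiv> perm_braiding X r \<sigma>"

lemma PG_group: "group PG"
  unfolding perm_group_def
  by (intro group.subgroup_imp_group group_BijGroup group_hom.img_is_subgroup group_hom.intro
    group_hom_axioms.intro SG_group perm_hom_hom)

lemma PG_carrier: "carrier PG = perm_hom X r ` carrier SG"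
  by (simp add: perm_group_def)

lemma PG_one: "\<one>\<^bsub>PG\<^esub> = \<one>\<^bsub>BijGroup X\<^esub>"
  by (simp add: perm_group_def)

lemma perm_hom_PG: "perm_hom X r \<in> hom SG PG"
  using perm_hom_hom by (auto simp: hom_def perm_group_def)

sublocale PG: group_hom SG PG "perm_hom X r"
  by (intro group_hom.intro group_hom_axioms.intro SG_group PG_group perm_hom_PG)

text \<open>\<L> is constant on cosets because \<open>H\<close> lies in its kernel. The statement
  covers both \<Gamma> and \<open>Fp\<close>.\<close>

lemma induced_perm_coset:
  assumes "H \<lhd> SG" "H \<subseteq> \<Gamma>" "g \<in> carrier SG"
  shows "induced_perm X r (H #>\<^bsub>SG\<^esub> g) = perm_hom X r g"
proof -
  have const: "perm_hom X r (h \<otimes>\<^bsub>SG\<^esub> g) = perm_hom X r g" if "h \<in> H" for h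
  proof -
    have h: "h \<in> carrier SG" "perm_hom X r h = \<one>\<^bsub>BijGroup X\<^esub>"
      using that assms(2) unfolding socle_eq_kernel kernel_def by blast+
    then show ?thesis
      using perm_hom_closed[OF assms(3)] hom_mult[OF perm_hom_hom h(1) assms(3)] by simp
  qed
  have one: "\<one>\<^bsub>SG\<^esub> \<in> H" using assms(1) by (simp add: normal_def subgroup.one_closed)
  have "H #>\<^bsub>SG\<^esub> g = (\<lambda>h. h \<otimes>\<^bsub>SG\<^esub> g) ` H" by (auto simp: r_coset_def)
  then have "perm_hom X r ` (H #>\<^bsub>SG\<^esub> g) = (\<lambda>h. perm_hom X r g) ` H"
    unfolding image_image using const by (simp only: image_image cong: image_cong)
  then have "perm_hom X r ` (H #>\<^bsub>SG\<^esub> g) = {perm_hom X r g}" using one by blast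
  then show ?thesis unfolding induced_perm_def by (simp only: the_elem_eq)
qed

lemma induced_perm_iso: "induced_perm X r \<in> iso (SG Mod \<Gamma>) PG"
proof -
  have "kernel SG PG (perm_hom X r) = \<Gamma>"
    unfolding socle_eq_kernel kernel_def by (simp only: PG_one)
  then show ?thesis
    using PG.FactGroup_iso_set PG_carrier unfolding induced_perm_def by simp
qed

text \<open>The inverse isomorphism sends the permutation of \<open>g\<close> to the coset of
  \<open>g\<close>, so the transported braiding can be computed on representatives in
  \<open>G\<close>.\<close>

lemma perm_braiding_perm_hom:
  assumes "a \<in> carrier SG" "b \<in> carrier SG"
  shows "PB (perm_hom X r a, perm_hom X r b) = map_prod (perm_hom X r) (perm_hom X r) (\<sigma> (a, b))"
proof -
  have inv: "inv_into (carrier (SG Mod \<Gamma>)) (induced_perm X r) (perm_hom X r g) = \<Gamma> #>\<^bsub>SG\<^esub> g"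
    if "g \<in> carrier SG" for g
  proof (rule inv_into_f_eq)
    show "inj_on (induced_perm X r) (carrier (SG Mod \<Gamma>))"
      using induced_perm_iso by (simp add: iso_def bij_betw_def)
    show "\<Gamma> #>\<^bsub>SG\<^esub> g \<in> carrier (SG Mod \<Gamma>)"
      using that by (auto simp: FactGroup_def RCOSETS_def)
    show "induced_perm X r (\<Gamma> #>\<^bsub>SG\<^esub> g) = perm_hom X r g"
      by (rule induced_perm_coset[OF B.socle_normal subset_refl that])
  qed
  have ind: "induced_perm X r (\<Gamma> #>\<^bsub>SG\<^esub> g) = perm_hom X r g" if "g \<in> carrier SG" for g
    by (rule induced_perm_coset[OF B.socle_normal subset_refl that])
  show ?thesis
    unfolding perm_braiding_def Let_def map_prod_simp inv[OF assms(1)] inv[OF assms(2)]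
      QS.quotient_braiding_coset[OF assms] B.sigma_eq
    using assms by (simp add: ind)
qed

lemma PG_braided: "involutive_braided_group PG PB \<and> braided_epi SG \<sigma> PG PB (perm_hom X r)"
  by (rule B.braided_image[OF PG_group perm_hom_PG]) (simp_all add: PG_carrier perm_braiding_perm_hom)

lemma induced_perm_epi:
  assumes "H \<lhd> SG" "H \<subseteq> \<Gamma>" "braided_ideal SG \<sigma> H"
  shows "braided_epi (SG Mod H) (quotient_braiding SG \<sigma> H) PG PB (induced_perm X r)"
proof -
  interpret H: braided_quotient SG \<sigma> H by unfold_locales (rule assms)
  show ?thesis
    using PG_braided H.quotient_braided induced_perm_coset[OF assms(1,2)]
    by (blast intro: braided_epi_factor)
qed

end

section \<open>Normal forms\<close>

context quadratic_set
begin

lemma ordered_word_lists: "set xs = X \<Longrightarrow> ordered_word xs \<alpha> \<in> lists X"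
  by (auto simp: ordered_word_def split: if_splits)

text \<open>A linear functional carries the normal form from the algebra to \<open>G\<close>: adding
  the coefficients of all words representing the class of \<open>w\<close> gives \<open>0\<close> on
  the relation ideal and \<open>1\<close> on \<open>w\<close>. It is therefore \<open>1\<close> on
  the normal form \<open>g\<close>, so some ordered word in \<open>g\<close> represents that
  class.\<close>

lemma admissible_ordered_word:
  assumes adm: "admissible TYPE('k::field) X r xs" and w: "w \<in> lists X"
  shows "\<exists>\<alpha>. word_elt X r w = word_elt X r (ordered_word xs \<alpha>)"
proof -
  define \<phi> :: "'a list \<Rightarrow> 'k \<Rightarrow> 'k"
    where "\<phi> v c = (if word_elt X r v = word_elt X r w then c else 0)" for v c
  define \<Phi> where "\<Phi> f = (\<Sum>v\<in>Poly_Mapping.keys f. \<phi> v (Poly_Mapping.lookup f v))" for f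
  have \<Phi>_add: "\<Phi> (f + g) = \<Phi> f + \<Phi> g" for f g
    unfolding \<Phi>_def by (rule setsum_keys_plus_distrib) (simp_all add: \<phi>_def)
  have \<Phi>_single: "\<Phi> (Poly_Mapping.single v c) = \<phi> v c" for v c
    by (simp add: \<Phi>_def \<phi>_def)
  have \<Phi>_ideal: "\<Phi> f = 0" if "f \<in> relation_ideal X r" for f
    using that
  proof (induction rule: relation_ideal.induct)
    case zero
    then show ?case by (simp add: \<Phi>_def)
  next
    case (add f u u' v v' c)
    have "word_elt X r (u @ v @ u') = word_elt X r (u @ v' @ u')"
      using add by (intro word_elt_rel)
    \<comment> \<open>The difference is treated as a sum with coefficient \<open>- c\<close>, so
      that additivity of \<Phi> applies.\<close>
    then have "\<phi> (u @ v @ u') c + \<phi> (u @ v' @ u') (- c) = 0" by (simp add: \<phi>_def)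
    then show ?case
      using add unfolding diff_conv_add_uminus single_uminus[symmetric] \<Phi>_add \<Phi>_single by simp
  qed
  have "Poly_Mapping.single w 1 \<in> free_algebra X" using w by (simp add: free_algebra_def)
  then obtain g :: "'a list \<Rightarrow>\<^sub>0 'k" where
    g: "Poly_Mapping.keys g \<subseteq> range (ordered_word xs)"
      "Poly_Mapping.single w 1 - g \<in> relation_ideal X r"
    using adm unfolding admissible_def by blast
  have "\<Phi> g = 1"
    using \<Phi>_add[of "Poly_Mapping.single w 1 - g" g] \<Phi>_ideal[OF g(2)] \<Phi>_single[of w 1]
    by (simp add: \<phi>_def)
  then obtain v where v: "v \<in> Poly_Mapping.keys g" "\<phi> v (Poly_Mapping.lookup g v) \<noteq> 0"
    unfolding \<Phi>_def by (metis sum.neutral zero_neq_one)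
  then have "word_elt X r w = word_elt X r v" by (simp add: \<phi>_def split: if_splits)
  then show ?thesis using g(1) v(1) by blast
qed

end

text \<open>\<open>ordered_form\<close> is the consequence of the basis property inside
  \<open>G\<close>; assuming it directly keeps the coefficient field out of the locale.\<close>

locale normal_form_solution = braided_solution +
  fixes xs
  assumes distinct_xs: "distinct xs" and set_xs: "set xs = X"
    and ordered_form: "w \<in> lists X \<Longrightarrow> \<exists>\<alpha>. word_elt X r w = word_elt X r (ordered_word xs \<alpha>)"
begin

section \<open>Every coset of \<open>Fp\<close> meets \<open>Y\<close>\<close>

abbreviation "Y \<equiv> bounded_monomials X r xs p"
abbreviation "\<pi> g \<equiv> Fp #>\<^bsub>SG\<^esub> g"

lemma coset_positive_word:
  assumes "g \<in> carrier SG"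
  shows "\<exists>w\<in>lists X. \<pi> g = \<pi> (word_elt X r w)"
  using assms
proof (induction rule: SG_induct)
  case one
  then show ?case by (intro bexI[of _ "[]"]) auto
next
  case (gen x g)
  then obtain w where w: "w \<in> lists X" "\<pi> g = \<pi> (word_elt X r w)" by blast
  have "\<pi> (gen X r x \<otimes>\<^bsub>SG\<^esub> g) = \<pi> (gen X r x \<otimes>\<^bsub>SG\<^esub> word_elt X r w)"
    by (rule Q.coset_mult_cong) (use gen.hyps w word_elt_closed gen_closed in auto)
  then show ?case
    using gen.hyps w by (intro bexI[of _ "x # w"]) (simp_all only: word_elt_Cons Cons_in_lists_iff)
next
  case (inv_gen x g)
  then obtain w where w: "w \<in> lists X" "\<pi> g = \<pi> (word_elt X r w)" by blast
  let ?x = "gen X r x" and ?u = "replicate (p - 1) x"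
  have x: "?x \<in> carrier SG" using inv_gen.hyps by (simp add: gen_closed)
  have u: "?u \<in> lists X" using inv_gen.hyps by auto
  \<comment> \<open>Positivity of \<open>p\<close> prevents truncation in \<open>p - 1\<close>; this
    trades an inverse letter for \<open>p - 1\<close> positive ones modulo
    \<open>Fp\<close>.\<close>
  have "?x [^]\<^bsub>SG\<^esub> p = ?x [^]\<^bsub>SG\<^esub> (p - 1) \<otimes>\<^bsub>SG\<^esub> ?x"
    using p_pos SG.nat_pow_Suc[of ?x "p - 1"] by simp
  then have "?x [^]\<^bsub>SG\<^esub> p \<otimes>\<^bsub>SG\<^esub> inv\<^bsub>SG\<^esub> ?x = ?x [^]\<^bsub>SG\<^esub> (p - 1)"
    using x by (simp add: SG.m_assoc)
  then have "\<pi> (inv\<^bsub>SG\<^esub> ?x) = \<pi> (word_elt X r ?u)"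
    using Q.coset_absorb[OF gen_pow_p_Fp, of x "inv\<^bsub>SG\<^esub> ?x"] inv_gen.hyps x
    by (simp add: word_elt_replicate)
  then have "\<pi> (inv\<^bsub>SG\<^esub> ?x \<otimes>\<^bsub>SG\<^esub> g) = \<pi> (word_elt X r ?u \<otimes>\<^bsub>SG\<^esub> word_elt X r w)"
    by (intro Q.coset_mult_cong) (use inv_gen.hyps x w u word_elt_closed in auto)
  then show ?case
    using u w by (intro bexI[of _ "?u @ w"]) (simp_all only: word_elt_append append_in_lists_conv)
qed

lemma coset_gen_pow_mod:
  assumes "x \<in> X"
  shows "\<pi> (gen X r x [^]\<^bsub>SG\<^esub> k) = \<pi> (gen X r x [^]\<^bsub>SG\<^esub> (k mod p))"
proof -
  let ?x = "gen X r x"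
  have x: "?x \<in> carrier SG" using assms by (rule gen_closed)
  have "(?x [^]\<^bsub>SG\<^esub> p) [^]\<^bsub>SG\<^esub> (k div p) \<in> Fp"
  proof (induction "k div p" arbitrary: k)
    case 0
    then show ?case by (metis Q.H.one_closed SG.nat_pow_0)
  next
    case (Suc d)
    \<comment> \<open>The induction is on \<open>k div p\<close>; the exponent \<open>d * p\<close>
      has quotient \<open>d\<close>.\<close>
    from Suc(1)[of "d * p"] Suc(2)[symmetric] show ?case
      using gen_pow_p_Fp[OF assms] p_pos by (simp add: Q.H.m_closed)
  qed
  moreover have "?x [^]\<^bsub>SG\<^esub> k = (?x [^]\<^bsub>SG\<^esub> p) [^]\<^bsub>SG\<^esub> (k div p) \<otimes>\<^bsub>SG\<^esub> ?x [^]\<^bsub>SG\<^esub> (k mod p)"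
    using x by (simp add: SG.nat_pow_pow SG.nat_pow_mult)
  ultimately show ?thesis using Q.coset_absorb x by simp
qed

lemma coset_ordered_word_mod:
  "\<pi> (word_elt X r (ordered_word xs \<alpha>)) = \<pi> (word_elt X r (ordered_word xs (\<lambda>i. \<alpha> i mod p)))"
proof -
  \<comment> \<open>The index list is generalised from \<open>[0..<length xs]\<close> to
    \<open>ks\<close>, so that induction can reduce one block of equal letters at a time.\<close>
  let ?w = "\<lambda>\<alpha> ks. concat (map (\<lambda>i. replicate (\<alpha> i) (xs ! i)) ks)"
  have words: "?w \<alpha> ks \<in> lists X" if "set ks \<subseteq> {..<length xs}" for \<alpha> ks
    using that set_xs nth_mem[of _ xs] by (fastforce split: if_splits)
  have "\<pi> (word_elt X r (?w \<alpha> ks)) = \<pi> (word_elt X r (?w (\<lambda>i. \<alpha> i mod p) ks))"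
    if "set ks \<subseteq> {..<length xs}" for ks
    using that
  proof (induction ks)
    case (Cons i ks)
    have i: "xs ! i \<in> X" using Cons.prems set_xs by auto
    have rep: "replicate k (xs ! i) \<in> lists X" for k using i by auto
    have ks: "set ks \<subseteq> {..<length xs}" using Cons.prems by simp
    have "\<pi> (word_elt X r (replicate (\<alpha> i) (xs ! i)) \<otimes>\<^bsub>SG\<^esub> word_elt X r (?w \<alpha> ks)) =
      \<pi> (word_elt X r (replicate (\<alpha> i mod p) (xs ! i)) \<otimes>\<^bsub>SG\<^esub>
        word_elt X r (?w (\<lambda>i. \<alpha> i mod p) ks))"
    proof (rule Q.coset_mult_cong)
      show "\<pi> (word_elt X r (replicate (\<alpha> i) (xs ! i))) =
          \<pi> (word_elt X r (replicate (\<alpha> i mod p) (xs ! i)))"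
        unfolding word_elt_replicate[OF i] by (rule coset_gen_pow_mod[OF i])
    qed (intro word_elt_closed rep words ks Cons.IH)+
    then show ?case
      using word_elt_append[OF rep words[OF ks]] by simp
  qed simp
  from this[of "[0..<length xs]"] show ?thesis
    unfolding ordered_word_def by (simp add: atLeast0LessThan)
qed

lemma Y_closed: "y \<in> Y \<Longrightarrow> y \<in> carrier SG"
  unfolding bounded_monomials_def using word_elt_closed[OF ordered_word_lists[OF set_xs]] by blast

text \<open>A representative is made a positive word, then an ordered word, and finally its
  exponents are reduced modulo \<open>p\<close>.\<close>

lemma coset_Y:
  assumes "g \<in> carrier SG"
  shows "\<exists>y\<in>Y. \<pi> g = \<pi> y"
proof -
  obtain w where w: "w \<in> lists X" "\<pi> g = \<pi> (word_elt X r w)"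
    using coset_positive_word[OF assms] by blast
  obtain \<alpha> where "word_elt X r w = word_elt X r (ordered_word xs \<alpha>)"
    using ordered_form[OF w(1)] by blast
  then have "\<pi> g = \<pi> (word_elt X r (ordered_word xs (\<lambda>i. \<alpha> i mod p)))"
    using w(2) coset_ordered_word_mod by simp
  moreover have "\<alpha> i mod p \<le> p - 1" for i
    using p_pos mod_less_divisor[of p "\<alpha> i"] by linarith
  then have "word_elt X r (ordered_word xs (\<lambda>i. \<alpha> i mod p)) \<in> Y"
    unfolding bounded_monomials_def by blast
  ultimately show ?thesis by blast
qed

text \<open>Cosets put the factor from \<open>Fp\<close> on the left; conjugation by
  \<open>y\<close> moves it to the right.\<close>

lemma coset_eq_factor:
  assumes "g \<in> carrier SG" "y \<in> carrier SG" "\<pi> g = \<pi> y"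
  shows "\<exists>W\<in>Fp. g = y \<otimes>\<^bsub>SG\<^esub> W"
proof -
  obtain h where h: "h \<in> Fp" "g = h \<otimes>\<^bsub>SG\<^esub> y" using Q.coset_eq_iff assms by blast
  have "inv\<^bsub>SG\<^esub> y \<otimes>\<^bsub>SG\<^esub> h \<otimes>\<^bsub>SG\<^esub> y \<in> Fp" using Q.H.inv_op_closed1[OF assms(2) h(1)] .
  moreover have "g = y \<otimes>\<^bsub>SG\<^esub> (inv\<^bsub>SG\<^esub> y \<otimes>\<^bsub>SG\<^esub> h \<otimes>\<^bsub>SG\<^esub> y)"
    using h assms Fp_closed[OF h(1)] by (simp add: SG.m_assoc[symmetric])
  ultimately show ?thesis by blast
qed

section \<open>Counting: \<open>Y\<close> is a transversal of \<open>Fp\<close>\<close>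

lemma card_X: "card X = length xs"
  using distinct_card[OF distinct_xs] set_xs by simp

text \<open>Exponents beyond the enumeration do not affect the word; discarding them leaves a finite
  index set of the right size.\<close>

lemma Y_image:
  "Y = (\<lambda>\<alpha>. word_elt X r (ordered_word xs \<alpha>)) ` ({..<length xs} \<rightarrow>\<^sub>E {..<p})"
proof
  show "(\<lambda>\<alpha>. word_elt X r (ordered_word xs \<alpha>)) ` ({..<length xs} \<rightarrow>\<^sub>E {..<p}) \<subseteq> Y"
    by (force simp: bounded_monomials_def PiE_iff)
  show "Y \<subseteq> (\<lambda>\<alpha>. word_elt X r (ordered_word xs \<alpha>)) ` ({..<length xs} \<rightarrow>\<^sub>E {..<p})"
  proof
    fix y assume "y \<in> Y"
    then obtain \<alpha> where \<alpha>: "\<forall>i<length xs. \<alpha> i \<le> p - 1" "y = word_elt X r (ordered_word xs \<alpha>)"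
      unfolding bounded_monomials_def by blast
    let ?\<alpha> = "restrict \<alpha> {..<length xs}"
    have "ordered_word xs ?\<alpha> = ordered_word xs \<alpha>"
      unfolding ordered_word_def by (intro arg_cong[where f = concat] map_cong) auto
    moreover have "\<alpha> i < p" if "i < length xs" for i
      using \<alpha>(1) that p_pos by (metis One_nat_def Suc_pred less_Suc_eq_le)
    then have "?\<alpha> \<in> {..<length xs} \<rightarrow>\<^sub>E {..<p}" by auto
    ultimately show "y \<in> (\<lambda>\<alpha>. word_elt X r (ordered_word xs \<alpha>)) ` ({..<length xs} \<rightarrow>\<^sub>E {..<p})"
      using \<alpha>(2) by (metis image_eqI)
  qed
qed

text \<open>\<open>residue\<close> is constant on cosets of \<open>Fp\<close> and every coset meets
  \<open>Y\<close>, so \<open>Y\<close> already attains all values.\<close>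

lemma residue_Y: "residue ` Y = (X \<rightarrow>\<^sub>E {0..<int p})"
proof -
  have "residue g \<in> residue ` Y" if g: "g \<in> carrier SG" for g
  proof -
    obtain y where y: "y \<in> Y" "\<pi> g = \<pi> y" using coset_Y[OF g] by blast
    then obtain W where "W \<in> Fp" "g = y \<otimes>\<^bsub>SG\<^esub> W" using coset_eq_factor[OF g] Y_closed by blast
    then show ?thesis using y residue_mult_Fp Y_closed by simp
  qed
  then have "residue ` carrier SG = residue ` Y" using Y_closed by blast
  then show ?thesis using residue_surj by simp
qed

text \<open>The bound \<open>card Y \<le> p ^ n\<close> is obvious, and \<open>residue\<close> maps \<open>Y\<close> onto a set of size \<open>p ^ n\<close>.\<close>

lemma card_Y: "card Y = p ^ card X" and inj_residue: "inj_on residue Y"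
  and finite_Y: "finite Y"
proof -
  show fin: "finite Y" unfolding Y_image by (intro finite_imageI finite_PiE) auto
  have "card Y \<le> p ^ card X"
    unfolding Y_image card_X
    using card_image_le[of "{..<length xs} \<rightarrow>\<^sub>E {..<p}"] by (simp add: finite_PiE card_PiE)
  moreover have "card (residue ` Y) = p ^ card X"
    unfolding residue_Y using finite_X by (simp add: card_PiE)
  moreover have "card (residue ` Y) \<le> card Y" using fin by (rule card_image_le)
  ultimately show "card Y = p ^ card X" "inj_on residue Y"
    using eq_card_imp_inj_on[OF fin, of residue] by auto
qed

text \<open>\<open>residue\<close> forgets the factor from \<open>Fp\<close> and is injective on
  \<open>Y\<close>; then \<open>y\<close> cancels.\<close>

lemma Y_unique:
  assumes "y \<in> Y" "y' \<in> Y" "W \<in> Fp" "W' \<in> Fp" "y \<otimes>\<^bsub>SG\<^esub> W = y' \<otimes>\<^bsub>SG\<^esub> W'"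
  shows "y = y'" "W = W'"
proof -
  have "residue y = residue y'"
    using assms residue_mult_Fp Y_closed by metis
  then show y: "y = y'" using inj_onD[OF inj_residue] assms(1,2) by blast
  show "W = W'"
    using assms y Y_closed Fp_closed by (metis SG.inv_solve_left SG.m_closed)
qed

lemma Y_factor_ex1:
  assumes g: "g \<in> carrier SG"
  shows "\<exists>!(y, W). y \<in> Y \<and> W \<in> Fp \<and> g = y \<otimes>\<^bsub>SG\<^esub> W"
proof -
  obtain y where y: "y \<in> Y" "\<pi> g = \<pi> y" using coset_Y[OF g] by blast
  obtain W where W: "W \<in> Fp" "g = y \<otimes>\<^bsub>SG\<^esub> W" using coset_eq_factor[OF g Y_closed] y by blast
  show ?thesis
  proof (rule ex1I[of _ "(y, W)"])
    fix q assume "case q of (y, W) \<Rightarrow> y \<in> Y \<and> W \<in> Fp \<and> g = y \<otimes>\<^bsub>SG\<^esub> W"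
    then obtain y' W' where q: "q = (y', W')" "y' \<in> Y" "W' \<in> Fp" "g = y' \<otimes>\<^bsub>SG\<^esub> W'"
      by (cases q) auto
    then have "y' \<otimes>\<^bsub>SG\<^esub> W' = y \<otimes>\<^bsub>SG\<^esub> W" using W(2) by metis
    then show "q = (y, W)" unfolding q(1) using Y_unique[OF q(2) y(1) q(3) W(1)] by blast
  next
    show "case (y, W) of (y, W) \<Rightarrow> y \<in> Y \<and> W \<in> Fp \<and> g = y \<otimes>\<^bsub>SG\<^esub> W"
      using y(1) W by (simp only: prod.case)
  qed
qed

section \<open>The quotient by \<open>Fp\<close>, described through \<open>Y\<close> and the image
  of \<open>X\<close>\<close>

lemma coset_mult_Fp: "\<lbrakk>y \<in> carrier SG; W \<in> Fp\<rbrakk> \<Longrightarrow> \<pi> (y \<otimes>\<^bsub>SG\<^esub> W) = \<pi> y"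
  by (rule Q.coset_mult_right)

lemma quotient_carrier: "carrier (SG Mod Fp) = (\<lambda>g. \<pi> g) ` Y"
proof -
  have "carrier (SG Mod Fp) = (\<lambda>g. \<pi> g) ` carrier SG"
    unfolding FactGroup_def RCOSETS_def by auto
  also have "\<dots> = (\<lambda>g. \<pi> g) ` Y"
  proof (intro equalityI subsetI)
    fix A assume "A \<in> (\<lambda>g. \<pi> g) ` carrier SG"
    then obtain g where "g \<in> carrier SG" "A = \<pi> g" by (elim imageE)
    then show "A \<in> (\<lambda>g. \<pi> g) ` Y" using coset_Y[of g] by (metis imageI)
  next
    fix A assume "A \<in> (\<lambda>g. \<pi> g) ` Y"
    then show "A \<in> (\<lambda>g. \<pi> g) ` carrier SG" using Y_closed by (elim imageE) simp
  qed
  finally show ?thesis .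
qed

lemma inj_coset_Y: "inj_on (\<lambda>g. \<pi> g) Y"
proof (rule inj_onI)
  fix y z assume yz: "y \<in> Y" "z \<in> Y" "\<pi> y = \<pi> z"
  then obtain W where W: "W \<in> Fp" "y = z \<otimes>\<^bsub>SG\<^esub> W" using coset_eq_factor Y_closed by blast
  then have "y \<otimes>\<^bsub>SG\<^esub> \<one>\<^bsub>SG\<^esub> = z \<otimes>\<^bsub>SG\<^esub> W" using Y_closed[OF yz(1)] by simp
  then show "y = z" using Y_unique(1)[OF yz(1,2) Q.H.one_closed W(1)] by blast
qed

lemma Y_product_ex1:
  assumes "y \<in> Y" "z \<in> Y"
  shows "\<exists>!t. t \<in> Y \<and> (\<exists>W\<in>Fp. y \<otimes>\<^bsub>SG\<^esub> z = t \<otimes>\<^bsub>SG\<^esub> W)"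
proof -
  have "y \<otimes>\<^bsub>SG\<^esub> z \<in> carrier SG" using assms Y_closed by simp
  then obtain t where t: "t \<in> Y" "\<pi> (y \<otimes>\<^bsub>SG\<^esub> z) = \<pi> t" "y \<otimes>\<^bsub>SG\<^esub> z \<in> carrier SG"
    using coset_Y by blast
  then have "\<exists>W\<in>Fp. y \<otimes>\<^bsub>SG\<^esub> z = t \<otimes>\<^bsub>SG\<^esub> W" using coset_eq_factor Y_closed by blast
  then show ?thesis using t(1) Y_unique(1) by metis
qed

lemma coset_Y_mult:
  assumes "y \<in> Y" "z \<in> Y" "t \<in> Y" "W \<in> Fp" "y \<otimes>\<^bsub>SG\<^esub> z = t \<otimes>\<^bsub>SG\<^esub> W"
  shows "\<pi> y \<otimes>\<^bsub>SG Mod Fp\<^esub> \<pi> z = \<pi> t"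
  using hom_mult[OF Q.H.r_coset_hom_Mod, of y z] assms coset_mult_Fp Y_closed by simp

text \<open>Residues at the coordinate \<open>x\<close> separate generators once \<open>0\<close>
  and \<open>1\<close> differ modulo \<open>p\<close>. For \<open>p = 1\<close> the quotient is
  trivial, so only a one-element \<open>X\<close> can embed.\<close>

lemma inj_coset_gen:
  assumes "p \<noteq> 1 \<or> card X = 1"
  shows "inj_on (\<lambda>x. \<pi> (gen X r x)) X"
proof (rule inj_onI)
  fix x y assume xy: "x \<in> X" "y \<in> X" "\<pi> (gen X r x) = \<pi> (gen X r y)"
  show "x = y"
  proof (cases "card X = 1")
    case True
    then show ?thesis using xy by (auto simp: card_1_singleton_iff)
  next
    case False
    then have "int p > 1" using assms p_pos by linarith
    obtain W where W: "W \<in> Fp" "gen X r x = gen X r y \<otimes>\<^bsub>SG\<^esub> W"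
      using coset_eq_factor gen_closed xy by blast
    have "residue (gen X r x) x = residue (gen X r y) x"
      unfolding W(2) using residue_mult_Fp gen_closed xy(2) W(1) by simp
    then show ?thesis
      using xy \<open>int p > 1\<close> by (simp add: residue_gen split: if_splits)
  qed
qed

lemma quotient_braiding_gen:
  assumes "x \<in> X" "y \<in> X"
  shows "quotient_braiding SG \<sigma> Fp (\<pi> (gen X r x), \<pi> (gen X r y)) =
    map_prod (\<lambda>z. \<pi> (gen X r z)) (\<lambda>z. \<pi> (gen X r z)) (r (x, y))"
  using sigma_gen[OF assms] unfolding Q.quotient_braiding_coset[OF assms[THEN gen_closed]]
  by (simp add: lact_def ract_def map_prod_def split: prod.splits)

lemma quotient_generated:
  "generate (SG Mod Fp) ((\<lambda>x. \<pi> (gen X r x)) ` X) = carrier (SG Mod Fp)"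
proof -
  interpret \<pi>: group_hom SG "SG Mod Fp" "\<lambda>g. \<pi> g"
    by (intro group_hom.intro group_hom_axioms.intro SG_group Q.H.factorgroup_is_group
      Q.H.r_coset_hom_Mod)
  have "generate (SG Mod Fp) ((\<lambda>g. \<pi> g) ` (gen X r ` X)) = (\<lambda>g. \<pi> g) ` generate SG (gen X r ` X)"
    by (rule \<pi>.generate_img) (auto simp: gen_closed)
  also have "\<dots> = carrier (SG Mod Fp)"
    unfolding SG_generated by (auto simp: FactGroup_def RCOSETS_def)
  finally show ?thesis by (simp add: image_image)
qed

lemma order_quotient: "order (SG Mod Fp) = p ^ card X"
  unfolding order_def quotient_carrier card_image[OF inj_coset_Y] by (rule card_Y)

lemma order_PG_dvd: "order PG dvd p ^ card X"
proof -
  have epi: "braided_epi (SG Mod Fp) (quotient_braiding SG \<sigma> Fp) PG PB (induced_perm X r)"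
    by (rule induced_perm_epi[OF Fp_normal Fp_subset_socle Fp_ideal])
  interpret f: group_hom "SG Mod Fp" PG "induced_perm X r"
    using epi by (intro group_hom.intro group_hom_axioms.intro Q.H.factorgroup_is_group PG_group)
      (simp add: braided_epi_def braided_hom_def)
  show ?thesis
    using f.order_image_dvd epi order_quotient by (simp add: braided_epi_def)
qed

end

text \<open>Injectivity on \<open>X\<close> is conditional because \<open>p = 1\<close> makes the
  quotient a group of order \<open>1\<close>, in which several points of \<open>X\<close> would
  coincide.\<close>

theorem theoremB:
  fixes X :: "'a set"
    and r :: "'a \<times> 'a \<Rightarrow> 'a \<times> 'a"
    and xs :: "'a list"
    and n p :: nat
    and G rG \<Gamma> \<G> r\<G> Y Fp Gt rt \<pi>
  assumes "finite X" and "card X = n"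
    and "solution X r" and "square_free X r"
    and "p = cyclic_degree X r"
    and "G = structure_group X r"
    and "associated_braiding X r rG"
    and "\<Gamma> = socle G rG"
    and "\<G> = perm_group X r"
    and "r\<G> = perm_braiding X r rG"
    and "admissible TYPE('k::field) X r xs"
    and "Y = bounded_monomials X r xs p"
    and "Fp = power_subgroup X r p"
    and "Gt = G Mod Fp"
    and "rt = quotient_braiding G rG Fp"
    and "\<pi> = (\<lambda>g. Fp #>\<^bsub>G\<^esub> g)"
  shows
    "(braided_ideal G rG Fp \<and> braided_ideal G rG \<Gamma> \<and>
      Fp \<subseteq> \<Gamma> \<and> braided_ideal (G\<lparr>carrier := \<Gamma>\<rparr>) rG Fp) \<and>
     (involutive_braided_group Gt rt \<and> finite (carrier Gt) \<and> order Gt = p ^ n \<and>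
      braided_epi G rG Gt rt \<pi> \<and>
      (\<forall>g\<in>carrier G. \<exists>!(y, W). y \<in> Y \<and> W \<in> Fp \<and> g = y \<otimes>\<^bsub>G\<^esub> W) \<and>
      (\<forall>y\<in>Y. \<forall>W\<in>Fp. \<pi> (y \<otimes>\<^bsub>G\<^esub> W) = \<pi> y) \<and>
      carrier Gt = \<pi> ` Y \<and>
      (\<forall>y\<in>Y. \<forall>z\<in>Y. \<exists>!t. t \<in> Y \<and> (\<exists>W\<in>Fp. y \<otimes>\<^bsub>G\<^esub> z = t \<otimes>\<^bsub>G\<^esub> W)) \<and>
      (\<forall>y\<in>Y. \<forall>z\<in>Y. \<forall>t\<in>Y. \<forall>W\<in>Fp. y \<otimes>\<^bsub>G\<^esub> z = t \<otimes>\<^bsub>G\<^esub> W \<longrightarrow> \<pi> y \<otimes>\<^bsub>Gt\<^esub> \<pi> z = \<pi> t) \<and>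
      bij_betw \<pi> Y (carrier Gt) \<and> card Y = p ^ n) \<and>
     ((p \<noteq> 1 \<or> n = 1 \<longrightarrow> inj_on (\<lambda>x. \<pi> (gen X r x)) X) \<and>
      (\<forall>x\<in>X. \<forall>y\<in>X. rt (\<pi> (gen X r x), \<pi> (gen X r y)) =
         map_prod (\<lambda>z. \<pi> (gen X r z)) (\<lambda>z. \<pi> (gen X r z)) (r (x, y))) \<and>
      generate Gt ((\<lambda>x. \<pi> (gen X r x)) ` X) = carrier Gt) \<and>
     (involutive_braided_group \<G> r\<G> \<and>
      induced_perm X r \<in> iso (G Mod \<Gamma>) \<G> \<and>
      braided_hom (G Mod \<Gamma>) (quotient_braiding G rG \<Gamma>) \<G> r\<G> (induced_perm X r) \<and>
      (\<exists>f. braided_epi Gt rt \<G> r\<G> f \<and> (\<forall>g\<in>carrier G. f (\<pi> g) = perm_hom X r g)) \<and>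
      order \<G> dvd p ^ n \<and>
      (Factorial_Ring.prime p \<longrightarrow> p_group p \<G>))"
proof -
  interpret S: finite_square_free_solution X r
    by unfold_locales (use assms in auto)
  have adm: "distinct xs" "set xs = X"
    using assms(11) by (auto simp: admissible_def)
  \<comment> \<open>Here the basis property of the algebra is converted into ordered forms in
    \<open>G\<close>.\<close>
  interpret S: normal_form_solution X r rG xs
  proof unfold_locales
    fix w assume "w \<in> lists X"
    then show "\<exists>\<alpha>. word_elt X r w = word_elt X r (ordered_word xs \<alpha>)"
      by (rule S.admissible_ordered_word[OF assms(11)])
  qed (use assms(7) adm in auto)
  \<comment> \<open>These equations replace every named object, and \<open>n\<close> by
    \<open>card X\<close>, so that the goal becomes the conjunction of the four parts.\<close>
  note eqs = assms(6,8,9,10) assms(14)[unfolded assms(13)] assms(15)[unfolded assms(13)]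
    assms(16)[unfolded assms(13)] assms(13) assms(12) assms(2)[symmetric] assms(5)
  have part1: "braided_ideal S.SG rG S.Fp \<and> braided_ideal S.SG rG S.\<Gamma> \<and>
      S.Fp \<subseteq> S.\<Gamma> \<and> braided_ideal (S.SG\<lparr>carrier := S.\<Gamma>\<rparr>) rG S.Fp"
    by (intro conjI S.Fp_ideal S.B.socle_ideal S.Fp_subset_socle S.Fp_ideal_socle)
  have fin: "finite (carrier (S.SG Mod S.Fp))"
    unfolding S.quotient_carrier by (rule finite_imageI[OF S.finite_Y])
  have part2: "involutive_braided_group (S.SG Mod S.Fp) (quotient_braiding S.SG rG S.Fp) \<and>
      finite (carrier (S.SG Mod S.Fp)) \<and> order (S.SG Mod S.Fp) = S.p ^ card X \<and>
      braided_epi S.SG rG (S.SG Mod S.Fp) (quotient_braiding S.SG rG S.Fp) (\<lambda>g. S.\<pi> g) \<and>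
      (\<forall>g\<in>carrier S.SG. \<exists>!(y, W). y \<in> S.Y \<and> W \<in> S.Fp \<and> g = y \<otimes>\<^bsub>S.SG\<^esub> W) \<and>
      (\<forall>y\<in>S.Y. \<forall>W\<in>S.Fp. S.\<pi> (y \<otimes>\<^bsub>S.SG\<^esub> W) = S.\<pi> y) \<and>
      carrier (S.SG Mod S.Fp) = (\<lambda>g. S.\<pi> g) ` S.Y \<and>
      (\<forall>y\<in>S.Y. \<forall>z\<in>S.Y. \<exists>!t. t \<in> S.Y \<and> (\<exists>W\<in>S.Fp. y \<otimes>\<^bsub>S.SG\<^esub> z = t \<otimes>\<^bsub>S.SG\<^esub> W)) \<and>
      (\<forall>y\<in>S.Y. \<forall>z\<in>S.Y. \<forall>t\<in>S.Y. \<forall>W\<in>S.Fp. y \<otimes>\<^bsub>S.SG\<^esub> z = t \<otimes>\<^bsub>S.SG\<^esub> W \<longrightarrow>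
        S.\<pi> y \<otimes>\<^bsub>S.SG Mod S.Fp\<^esub> S.\<pi> z = S.\<pi> t) \<and>
      bij_betw (\<lambda>g. S.\<pi> g) S.Y (carrier (S.SG Mod S.Fp)) \<and> card S.Y = S.p ^ card X"
    by (intro conjI ballI impI S.Q.quotient_braided[THEN conjunct1] fin S.order_quotient
      S.Q.quotient_braided[THEN conjunct2] S.Y_factor_ex1 S.coset_mult_Fp[OF S.Y_closed]
      S.quotient_carrier S.Y_product_ex1 S.coset_Y_mult S.card_Y
      bij_betw_imageI[OF S.inj_coset_Y S.quotient_carrier[symmetric]])
  have part3: "(S.p \<noteq> 1 \<or> card X = 1 \<longrightarrow> inj_on (\<lambda>x. S.\<pi> (gen X r x)) X) \<and>
      (\<forall>x\<in>X. \<forall>y\<in>X. quotient_braiding S.SG rG S.Fp (S.\<pi> (gen X r x), S.\<pi> (gen X r y)) =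
         map_prod (\<lambda>z. S.\<pi> (gen X r z)) (\<lambda>z. S.\<pi> (gen X r z)) (r (x, y))) \<and>
      generate (S.SG Mod S.Fp) ((\<lambda>x. S.\<pi> (gen X r x)) ` X) = carrier (S.SG Mod S.Fp)"
    by (intro conjI ballI impI S.inj_coset_gen S.quotient_braiding_gen S.quotient_generated)
  have part4: "involutive_braided_group S.PG S.PB \<and>
      induced_perm X r \<in> iso (S.SG Mod S.\<Gamma>) S.PG \<and>
      braided_hom (S.SG Mod S.\<Gamma>) (quotient_braiding S.SG rG S.\<Gamma>) S.PG S.PB (induced_perm X r) \<and>
      (\<exists>f. braided_epi (S.SG Mod S.Fp) (quotient_braiding S.SG rG S.Fp) S.PG S.PB f \<and>
        (\<forall>g\<in>carrier S.SG. f (S.\<pi> g) = perm_hom X r g)) \<and>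
      order S.PG dvd S.p ^ card X \<and> (Factorial_Ring.prime S.p \<longrightarrow> p_group S.p S.PG)"
  proof (intro conjI impI exI[of _ "induced_perm X r"] ballI)
    show "involutive_braided_group S.PG S.PB" using S.PG_braided by blast
    show "induced_perm X r \<in> iso (S.SG Mod S.\<Gamma>) S.PG" by (rule S.induced_perm_iso)
    show "braided_hom (S.SG Mod S.\<Gamma>) (quotient_braiding S.SG rG S.\<Gamma>) S.PG S.PB (induced_perm X r)"
      using S.induced_perm_epi[OF S.B.socle_normal subset_refl S.B.socle_ideal]
      unfolding braided_epi_def by blast
    show "braided_epi (S.SG Mod S.Fp) (quotient_braiding S.SG rG S.Fp) S.PG S.PB (induced_perm X r)"
      by (rule S.induced_perm_epi[OF S.Fp_normal S.Fp_subset_socle S.Fp_ideal])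
    show "induced_perm X r (S.\<pi> g) = perm_hom X r g" if "g \<in> carrier S.SG" for g
      by (rule S.induced_perm_coset[OF S.Fp_normal S.Fp_subset_socle that])
    show "order S.PG dvd S.p ^ card X" by (rule S.order_PG_dvd)
    show "p_group S.p S.PG" if "Factorial_Ring.prime S.p"
      by (rule p_group_if_order_dvd[OF S.PG_group S.order_PG_dvd that])
  qed
  show ?thesis
    unfolding eqs by (rule conjI[OF part1 conjI[OF part2 conjI[OF part3 part4]]])
qed

end
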